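(* Let $L>0$, $n\ge 1$, and let $A(\cdot)$ be a real $n\times n$ symmetric matrix valued function on $[0,L]$ with continuous entries such that the Neumann problem $$u''(x)+A(x)u(x)=0,\ x\in(0,L),\qquad u'(0)=u'(L)=0 \qquad (\mathrm{N})$$ (with $u:[0,L]\to\mathbb{R}^n$) has no nontrivial constant solutions and $$\int_0^L \langle A(x)k,k\rangle\,dx\ge 0\quad \text{for all } k\in\mathbb{R}^n .$$ Suppose there exist a diagonal matrix function $B(x)$ with continuous diagonal entries $b_{ii}(x)$, $x\in[0,L]$, and $p_i\in[1,\infty]$, $1\le i\le n$, such that $A(x)\le B(x)$ for all $x\in[0,L]$ and, for each $1\le i\le n$, $$\|b_{ii}^+\|_{p_i}<\beta_{p_i}\ \text{ if } p_i\in(1,\infty],\qquad \|b_{ii}^+\|_{p_i}\le\beta_{p_i}\ \text{ if } p_i=1 .$$ Then problem $(\mathrm{N})$ has no nontrivial solution.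
   Context: $\langle\cdot,\cdot\rangle$ is the usual scalar product in $\mathbb{R}^n$. For $n\times n$ matrices, $C\le D$ means that $D-C$ is positive semi-definite. For a real function $f$, $f^+(x)=\max\{f(x),0\}$, and $\|\cdot\|_p$ is the usual norm of $L^p(0,L)$. Solutions are understood as $u\in (H^1(0,L))^n$ in the weak sense: $\int_0^L\langle u',v'\rangle\,dx=\int_0^L\langle A(x)u,v\rangle\,dx$ for all $v\in (H^1(0,L))^n$. The constants $\beta_p$ ($1\le p\le\infty$) depend on $p$ and $L$ and are defined by $\beta_p=\min_{X_p\setminus\{0\}} I_p$ (the minimum is attained), where: for $p=1$: $X_1=\{v\in H^1(0,L):\max_{[0,L]}v+\min_{[0,L]}v=0\}$ and $I_1(v)=\dfrac{\int_0^L v'^2}{\|v\|_\infty^2}$; for $1<p<\infty$: $X_p=\{v\in H^1(0,L):\int_0^L|v|^{\frac{2}{p-1}}v=0\}$ and $I_p(v)=\dfrac{\int_0^L v'^2}{\left(\int_0^L|v|^{\frac{2p}{p-1}}\right)^{\frac{p-1}{p}}}$; for $p=\infty$: $X_\infty=\{v\in H^1(0,L):\int_0^L v=0\}$ and $I_\infty(v)=\dfrac{\int_0^L v'^2}{\int_0^L v^2}$. (In particular $\beta_1=4/L$ and $\beta_\infty=\pi^2/L^2$.) *)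

theory Defs
  imports "HOL-Analysis.Analysis" "HOL-Probability.Essential_Supremum"
begin

abbreviation leb :: "real \<Rightarrow> real measure" where
  "leb L \<equiv> lebesgue_on {0<..<L}"

text \<open>
  Elements of \<open>L\<^sup>2(0,L)\<close> and \<open>H\<^sup>1(0,L)\<close> are represented by functions \<open>real \<Rightarrow> real\<close>
  considered up to equality almost everywhere on \<open>(0,L)\<close>; their values outside \<open>(0,L)\<close>
  are irrelevant, except where the continuous representative on \<open>[0,L]\<close> is requested.
\<close>

definition L2 :: "real \<Rightarrow> (real \<Rightarrow> real) \<Rightarrow> bool" where
  "L2 L f \<longleftrightarrow> f \<in> borel_measurable (leb L) \<and> integrable (leb L) (\<lambda>x. (f x)\<^sup>2)"

text \<open>\<open>C\<^sup>1\<close> test functions; the support, being closed and bounded, is automatically compact.\<close>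

definition test_function :: "real \<Rightarrow> (real \<Rightarrow> real) \<Rightarrow> bool" where
  "test_function L \<phi> \<longleftrightarrow>
     \<phi> C1_differentiable_on UNIV \<and> closure {x. \<phi> x \<noteq> 0} \<subseteq> {0<..<L}"

definition has_weak_deriv :: "real \<Rightarrow> (real \<Rightarrow> real) \<Rightarrow> (real \<Rightarrow> real) \<Rightarrow> bool" where
  "has_weak_deriv L v g \<longleftrightarrow> L2 L g \<and>
     (\<forall>\<phi>. test_function L \<phi> \<longrightarrow>
        (LINT x|leb L. v x * deriv \<phi> x) = - (LINT x|leb L. g x * \<phi> x))"

definition H1 :: "real \<Rightarrow> (real \<Rightarrow> real) set" where
  "H1 L = {v. L2 L v \<and> (\<exists>g. has_weak_deriv L v g)}"

text \<open>The weak derivative is unique up to equality almost everywhere, so under an integral the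
  choice is immaterial.\<close>

definition weak_deriv :: "real \<Rightarrow> (real \<Rightarrow> real) \<Rightarrow> real \<Rightarrow> real" where
  "weak_deriv L v = (SOME g. has_weak_deriv L v g)"

text \<open>The norm of \<open>L\<^sup>p(0,L)\<close> for \<open>1 \<le> p \<le> \<infinity>\<close>, meaningful for \<open>f\<close> in that space.\<close>

definition Lp_norm :: "real \<Rightarrow> ereal \<Rightarrow> (real \<Rightarrow> real) \<Rightarrow> real" where
  "Lp_norm L p f =
     (if p = \<infinity> then real_of_ereal (esssup (leb L) (\<lambda>x. ereal \<bar>f x\<bar>))
      else (LINT x|leb L. \<bar>f x\<bar> powr real_of_ereal p) powr (1 / real_of_ereal p))"

text \<open>For \<open>p = 1\<close> the extrema over \<open>[0,L]\<close> refer to the continuous representative, for which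
  \<open>Sup\<close> and \<open>Inf\<close> are the maximum and the minimum.\<close>

definition X_space :: "real \<Rightarrow> ereal \<Rightarrow> (real \<Rightarrow> real) set" where
  "X_space L p =
     (if p = 1 then
        {v \<in> H1 L. continuous_on {0..L} v \<and> Sup (v ` {0..L}) + Inf (v ` {0..L}) = 0}
      else if p = \<infinity> then
        {v \<in> H1 L. (LINT x|leb L. v x) = 0}
      else
        {v \<in> H1 L. (LINT x|leb L. \<bar>v x\<bar> powr (2 / (real_of_ereal p - 1)) * v x) = 0})"

definition I_functional :: "real \<Rightarrow> ereal \<Rightarrow> (real \<Rightarrow> real) \<Rightarrow> real" where
  "I_functional L p v =
     (LINT x|leb L. (weak_deriv L v x)\<^sup>2) /
     (if p = 1 then (Lp_norm L \<infinity> v)\<^sup>2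
      else if p = \<infinity> then (LINT x|leb L. (v x)\<^sup>2)
      else (let q = real_of_ereal p in
        (LINT x|leb L. \<bar>v x\<bar> powr (2 * q / (q - 1))) powr ((q - 1) / q)))"

text \<open>The infimum below is attained, i.e. it is a minimum.\<close>

definition beta :: "real \<Rightarrow> ereal \<Rightarrow> real" where
  "beta L p = Inf (I_functional L p ` {v \<in> X_space L p. \<not> (AE x in leb L. v x = 0)})"

definition psd :: "real^'n^'n \<Rightarrow> bool" where
  "psd M \<longleftrightarrow> transpose M = M \<and> (\<forall>k. 0 \<le> (M *v k) \<bullet> k)"

definition H1_vec :: "real \<Rightarrow> (real \<Rightarrow> real^'n) set" where
  "H1_vec L = {u. \<forall>i. (\<lambda>x. u x $ i) \<in> H1 L}"

definition weak_deriv_vec :: "real \<Rightarrow> (real \<Rightarrow> real^'n) \<Rightarrow> real \<Rightarrow> real^'n" where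
  "weak_deriv_vec L u x = (\<chi> i. weak_deriv L (\<lambda>y. u y $ i) x)"

text \<open>Weak solutions of \<open>u'' + A u = 0\<close> with \<open>u'(0) = u'(L) = 0\<close>; the boundary condition is
  encoded by testing against all of \<open>H\<^sup>1\<close>.\<close>

definition neumann_solution ::
  "real \<Rightarrow> (real \<Rightarrow> real^'n^'n) \<Rightarrow> (real \<Rightarrow> real^'n) \<Rightarrow> bool" where
  "neumann_solution L A u \<longleftrightarrow> u \<in> H1_vec L \<and>
     (\<forall>v \<in> H1_vec L.
        (LINT x|leb L. weak_deriv_vec L u x \<bullet> weak_deriv_vec L v x) =
        (LINT x|leb L. (A x *v u x) \<bullet> v x))"

end

theory Submission
  imports Defs
begin

text \<open>
  Let \<open>u\<close> be a solution and \<open>k\<close> a constant vector. Testing with \<open>k\<close> and with \<open>u\<close> gives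
  \<open>\<integral>\<langle>A(u+k),u+k\<rangle> = \<integral>\<bar>u'\<bar>\<^sup>2 + \<integral>\<langle>Ak,k\<rangle> \<ge> \<integral>\<bar>u'\<bar>\<^sup>2\<close>, while \<open>A \<le> B\<close> bounds the left-hand side by
  \<open>\<Sum>\<^sub>i \<integral> b\<^sub>i\<^sub>i (u\<^sub>i+k\<^sub>i)\<^sup>2\<close>. Choose each \<open>k\<^sub>i\<close> so that \<open>u\<^sub>i + k\<^sub>i\<close> lies in the constraint space
  of \<open>\<beta>\<close> for the exponent \<open>p\<^sub>i\<close>. Then the \<open>i\<close>-th summand is smaller than \<open>\<integral>u\<^sub>i'\<^sup>2\<close> unless
  \<open>u\<^sub>i + k\<^sub>i = 0\<close>: by the inequality of Hoelder for \<open>p\<^sub>i > 1\<close>, and for \<open>p\<^sub>i = 1\<close> since equality would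
  force \<open>b\<^sub>i\<^sub>i\<^sup>+\<close> to live where \<open>\<bar>u\<^sub>i + k\<^sub>i\<bar>\<close> is maximal. Hence \<open>u\<close> is constant, so it vanishes.
\<close>

section \<open>Integrals and almost-everywhere statements on the open interval\<close>

lemma finite_measure_leb: "finite_measure (leb L)"
  by (rule finite_measure_lebesgue_on) simp

lemma integrable_leb_continuous:
  fixes f :: "real \<Rightarrow> real"
  assumes "continuous_on {0..L} f"
  shows "integrable (leb L) f"
proof -
  have "integrable (lebesgue_on {0..L}) f"
    using assms by (rule continuous_imp_integrable_real)
  then have "set_integrable lebesgue {0..L} f"
    by (simp add: integrable_restrict_space set_integrable_def)
  then have "set_integrable lebesgue {0<..<L} f"
    by (rule set_integrable_subset) auto
  then show ?thesis
    by (simp add: integrable_restrict_space set_integrable_def)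
qed

lemma id_measurable_leb: "(\<lambda>x. x) \<in> borel_measurable (leb L)"
  using integrable_leb_continuous[of L "\<lambda>x. x"] by auto

lemma indicator_measurable_leb:
  "S \<in> sets borel \<Longrightarrow> (\<lambda>x. indicator S x :: real) \<in> borel_measurable (leb L)"
  by (rule measurable_compose[OF id_measurable_leb borel_measurable_indicator])

lemma integrable_leb_mult_indicator:
  fixes f :: "real \<Rightarrow> real"
  assumes "integrable (leb L) f" "S \<in> sets borel"
  shows "integrable (leb L) (\<lambda>x. f x * indicator S x)"
proof (rule Bochner_Integration.integrable_bound[OF assms(1)])
  show "(\<lambda>x. f x * indicator S x) \<in> borel_measurable (leb L)"
    using assms by (intro borel_measurable_times indicator_measurable_leb) auto
  show "AE x in leb L. norm (f x * indicator S x) \<le> norm (f x)"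
    by (intro AE_I2) (auto simp: indicator_def)
qed

text \<open>The endpoints form a null set, so the gauge integral over the closed interval takes the
  same value. It supplies additivity over intervals and the fundamental theorem of calculus.\<close>

lemma integral_leb:
  fixes f :: "real \<Rightarrow> real"
  assumes "integrable (leb L) f"
  shows "(LINT x|leb L. f x) = integral {0..L} f"
  using lebesgue_integral_eq_integral[OF assms] by (simp add: integral_open_interval_real)

lemma integrable_leb_imp_integrable_on:
  fixes f :: "real \<Rightarrow> real"
  assumes "integrable (leb L) f"
  shows "f integrable_on {0..L}"
  using integrable_on_lebesgue_on[OF assms] by (simp add: integrable_on_open_interval_real)

lemma AE_leb_iff: "(AE x in leb L. P x) \<longleftrightarrow> (AE x in lebesgue. 0 < x \<and> x < L \<longrightarrow> P x)"
  by (subst AE_restrict_space_iff) (auto simp: greaterThanLessThan_iff)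

lemma AE_leb_I: "(\<And>x. 0 < x \<Longrightarrow> x < L \<Longrightarrow> P x) \<Longrightarrow> AE x in leb L. P x"
  by (simp add: AE_leb_iff)

text \<open>A closed set containing almost every point of an open set contains that open set;
  passing to the closure adds the two endpoints.\<close>

lemma AE_leb_le_imp_le:
  fixes f :: "real \<Rightarrow> real"
  assumes L: "0 < L" and f: "continuous_on {0..L} f" and ae: "AE x in leb L. f x \<le> c"
    and x: "x \<in> {0..L}"
  shows "f x \<le> c"
proof -
  define C where "C = {x \<in> {0..L}. f x \<le> c}"
  have C: "closed C"
    unfolding C_def using f by (intro continuous_on_closed_Collect_le continuous_intros) auto
  have "{0<..<L} \<subseteq> C"
  proof
    fix y assume "y \<in> {0<..<L}"
    moreover have "AE x \<in> {0<..<L} in lebesgue. x \<in> C"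
      using ae unfolding AE_leb_iff C_def by eventually_elim auto
    ultimately show "y \<in> C"
      using mem_closed_if_AE_lebesgue_open[of "{0<..<L}" C y] C by auto
  qed
  then have "closure {0<..<L} \<subseteq> C"
    using C by (rule closure_minimal)
  with x L show ?thesis by (auto simp: C_def)
qed

lemma AE_leb_eq_imp_eq:
  fixes f :: "real \<Rightarrow> real"
  assumes L: "0 < L" and f: "continuous_on {0..L} f" and ae: "AE x in leb L. f x = c"
    and x: "x \<in> {0..L}"
  shows "f x = c"
proof (rule antisym)
  have "AE x in leb L. f x \<le> c" using ae by eventually_elim simp
  with x show "f x \<le> c" by (intro AE_leb_le_imp_le[OF L f])
  have "AE x in leb L. - f x \<le> - c" using ae by eventually_elim simp
  then show "c \<le> f x"
    using AE_leb_le_imp_le[OF L _ _ x, of "\<lambda>x. - f x" "- c"] f by (auto intro: continuous_intros)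
qed

subsection \<open>Test functions\<close>

text \<open>A cutoff that passes from 0 to 1 on the unit interval. It is built from squared positive
  parts because \<open>(max 0 t)^2\<close> is the simplest C1 function that vanishes on a
  half-line.\<close>

definition smooth_step :: "real \<Rightarrow> real" where
  "smooth_step t = 1 - (max 0 (1 - (max 0 t)\<^sup>2))\<^sup>2"

lemma smooth_step_eq_0: "t \<le> 0 \<Longrightarrow> smooth_step t = 0"
  and smooth_step_eq_1: "1 \<le> t \<Longrightarrow> smooth_step t = 1"
  by (simp_all add: smooth_step_def max_def power_le_one_iff)

lemma abs_smooth_step_le_1: "\<bar>smooth_step t\<bar> \<le> 1"
proof -
  have "(max 0 (1 - (max 0 t)\<^sup>2))\<^sup>2 \<le> (1::real)"
    by (rule power_le_one) auto
  moreover have "0 \<le> (max 0 (1 - (max 0 t)\<^sup>2))\<^sup>2" by simp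
  ultimately show ?thesis unfolding smooth_step_def by linarith
qed

lemma has_real_derivative_max_0_square:
  "((\<lambda>t::real. (max 0 t)\<^sup>2) has_real_derivative 2 * max 0 t) (at t)"
proof -
  consider "t < 0" | "t = 0" | "t > 0" by linarith
  then show ?thesis
  proof cases
    case 1
    have "((\<lambda>t::real. 0) has_real_derivative 2 * max 0 t) (at t)" using 1 by simp
    then show ?thesis
      by (rule has_field_derivative_transform_within_open[where S = "{..<0}"]) (use 1 in auto)
  next
    case 2
    \<comment> \<open>At the kink the difference quotient is either 0 or \<open>h\<close>.\<close>
    have "((\<lambda>h::real. (max 0 h)\<^sup>2 / h) \<longlongrightarrow> 0) (at 0)"
    proof (rule Lim_null_comparison)
      show "eventually (\<lambda>h::real. norm ((max 0 h)\<^sup>2 / h) \<le> \<bar>h\<bar>) (at 0)"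
        by (auto simp: max_def power2_eq_square)
      show "((\<lambda>h::real. \<bar>h\<bar>) \<longlongrightarrow> 0) (at 0)"
        by (rule tendsto_eq_intros | simp)+
    qed
    then show ?thesis using 2 by (simp add: DERIV_def)
  next
    case 3
    have "((\<lambda>t::real. t\<^sup>2) has_real_derivative 2 * max 0 t) (at t)"
      using 3 by (auto intro!: derivative_eq_intros)
    then show ?thesis
      by (rule has_field_derivative_transform_within_open[where S = "{0<..}"]) (use 3 in auto)
  qed
qed

lemma C1_differentiable_on_max_0_square:
  fixes f :: "real \<Rightarrow> real"
  assumes "f C1_differentiable_on UNIV"
  shows "(\<lambda>x. (max 0 (f x))\<^sup>2) C1_differentiable_on UNIV"
proof -
  obtain D where D: "\<And>x. (f has_real_derivative D x) (at x)" and contD: "continuous_on UNIV D"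
    using assms by (auto simp: C1_differentiable_on_def has_real_derivative_iff_has_vector_derivative)
  have "((\<lambda>x. (max 0 (f x))\<^sup>2) has_real_derivative 2 * max 0 (f x) * D x) (at x)" for x
    using DERIV_chain2[OF has_real_derivative_max_0_square D] .
  moreover have "continuous_on UNIV (\<lambda>x. 2 * max 0 (f x) * D x)"
    using contD C1_differentiable_imp_continuous_on[OF assms] by (intro continuous_intros)
  ultimately show ?thesis
    unfolding C1_differentiable_on_def has_real_derivative_iff_has_vector_derivative
    by (intro exI[of _ "\<lambda>x. 2 * max 0 (f x) * D x"]) auto
qed

lemma C1_differentiable_on_smooth_step:
  assumes "f C1_differentiable_on UNIV"
  shows "(\<lambda>x. smooth_step (f x)) C1_differentiable_on UNIV"
  unfolding smooth_step_def
  by (intro C1_differentiable_on_diff C1_differentiable_on_const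
      C1_differentiable_on_max_0_square assms)

text \<open>The shift by 1 makes the function vanish within distance 1/n of \<open>a\<close> and
  \<open>b\<close>, which keeps the support compactly inside the open interval. From distance 2/n
  on, each factor equals 1.\<close>

definition bump :: "real \<Rightarrow> real \<Rightarrow> nat \<Rightarrow> real \<Rightarrow> real" where
  "bump a b n x = smooth_step (real n * (x - a) - 1) * smooth_step (real n * (b - x) - 1)"

lemma abs_bump_le_1: "\<bar>bump a b n x\<bar> \<le> 1"
  unfolding bump_def abs_mult using abs_smooth_step_le_1 by (intro mult_le_one) auto

lemma C1_differentiable_on_bump: "bump a b n C1_differentiable_on UNIV"
  unfolding bump_def[abs_def]
  by (intro C1_differentiable_on_mult C1_differentiable_on_smooth_step C1_differentiable_on_diff
      C1_differentiable_on_const C1_differentiable_on_ident)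

lemma test_function_bump:
  assumes "0 \<le> a" "b \<le> L" "n > 0"
  shows "test_function L (bump a b n)"
proof -
  have "{x. bump a b n x \<noteq> 0} \<subseteq> {a + 1 / n .. b - 1 / n}"
  proof
    fix x assume "x \<in> {x. bump a b n x \<noteq> 0}"
    then have "smooth_step (real n * (x - a) - 1) \<noteq> 0" "smooth_step (real n * (b - x) - 1) \<noteq> 0"
      by (auto simp: bump_def)
    then have "real n * (x - a) - 1 > 0" "real n * (b - x) - 1 > 0"
      using smooth_step_eq_0 by (meson not_le)+
    then show "x \<in> {a + 1 / n .. b - 1 / n}"
      using assms by (auto simp: field_simps)
  qed
  then have "closure {x. bump a b n x \<noteq> 0} \<subseteq> {a + 1 / n .. b - 1 / n}"
    by (rule closure_minimal) auto
  moreover have "{a + 1 / n .. b - 1 / n} \<subseteq> {0<..<L}"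
  proof
    fix x assume "x \<in> {a + 1 / n .. b - 1 / n}"
    moreover have "1 / real n > 0" using assms by simp
    ultimately show "x \<in> {0<..<L}"
      unfolding atLeastAtMost_iff greaterThanLessThan_iff using assms(1,2) by linarith
  qed
  ultimately show ?thesis
    by (auto simp: test_function_def C1_differentiable_on_bump)
qed

lemma bump_tendsto_indicator: "(\<lambda>n. bump a b n x) \<longlonglongrightarrow> indicator {a<..<b} x"
proof (cases "x \<in> {a<..<b}")
  case True
  have "eventually (\<lambda>n. 2 / (x - a) \<le> real n) sequentially"
    "eventually (\<lambda>n. 2 / (b - x) \<le> real n) sequentially"
    using filterlim_real_sequentially by (auto simp: filterlim_at_top)
  then have "eventually (\<lambda>n. bump a b n x = 1) sequentially"
  proof eventually_elim
    case (elim n)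
    then have "real n * (x - a) \<ge> 2" "real n * (b - x) \<ge> 2"
      using True by (auto simp: field_simps)
    then show ?case by (simp add: bump_def smooth_step_eq_1)
  qed
  then show ?thesis using True by (simp add: tendsto_eventually)
next
  case False
  have "bump a b n x = 0" for n
  proof (cases "x \<le> a")
    case True
    then have "real n * (x - a) \<le> 0" by (simp add: mult_nonneg_nonpos)
    then show ?thesis by (simp add: bump_def smooth_step_eq_0)
  next
    case F: False
    then have "real n * (b - x) \<le> 0" using False by (simp add: mult_nonneg_nonpos)
    then show ?thesis by (simp add: bump_def smooth_step_eq_0)
  qed
  then show ?thesis using False by simp
qed

lemma continuous_on_test_function:
  assumes "test_function L \<phi>"
  shows "continuous_on S \<phi>"
proof -
  have "continuous_on UNIV \<phi>"
    using assms C1_differentiable_imp_continuous_on by (auto simp: test_function_def)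
  then show ?thesis by (rule continuous_on_subset) auto
qed

lemma test_function_has_deriv:
  assumes "test_function L \<phi>"
  shows "(\<phi> has_real_derivative deriv \<phi> x) (at x)"
proof -
  have "\<phi> differentiable at x"
    using assms by (auto simp: test_function_def C1_differentiable_on_eq)
  then show ?thesis by (simp add: DERIV_deriv_iff_real_differentiable)
qed

lemma continuous_on_deriv_test_function:
  assumes "test_function L \<phi>"
  shows "continuous_on S (deriv \<phi>)"
proof -
  have "vector_derivative \<phi> (at x) = deriv \<phi> x" for x
    using test_function_has_deriv[OF assms]
    by (simp add: has_real_derivative_iff_has_vector_derivative vector_derivative_at)
  then have "continuous_on UNIV (deriv \<phi>)"
    using assms by (auto simp: test_function_def C1_differentiable_on_eq)
  then show ?thesis by (rule continuous_on_subset) auto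
qed

lemma test_function_eq_0:
  assumes "test_function L \<phi>" "x \<notin> {0<..<L}"
  shows "\<phi> x = 0"
  using assms closure_subset[of "{x. \<phi> x \<noteq> 0}"] by (auto simp: test_function_def)

section \<open>The fundamental lemma of the calculus of variations and the lemma of du
  Bois-Reymond\<close>

lemma integrable_mult_continuous:
  fixes f g :: "real \<Rightarrow> real"
  assumes f: "integrable (leb L) f" and g: "continuous_on {0..L} g"
  shows "integrable (leb L) (\<lambda>x. f x * g x)"
proof -
  have "compact (g ` {0..L})" using g by (intro compact_continuous_image) auto
  then obtain C where C: "\<And>x. x \<in> {0..L} \<Longrightarrow> \<bar>g x\<bar> \<le> C"
    unfolding real_norm_def[symmetric] by (meson bounded_iff compact_imp_bounded imageI)
  show ?thesis
  proof (rule Bochner_Integration.integrable_bound)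
    show "integrable (leb L) (\<lambda>x. f x * C)" using f by simp
    show "(\<lambda>x. f x * g x) \<in> borel_measurable (leb L)"
      using f integrable_leb_continuous[OF g] by (intro borel_measurable_times) auto
    show "AE x in leb L. norm (f x * g x) \<le> norm (f x * C)"
    proof (rule AE_leb_I)
      fix x assume "0 < x" "x < L"
      then have "\<bar>g x\<bar> \<le> \<bar>C\<bar>" using C[of x] by auto
      then show "norm (f x * g x) \<le> norm (f x * C)" by (simp add: abs_mult mult_left_mono)
    qed
  qed
qed

lemma integral_leb_mult_indicator:
  fixes f :: "real \<Rightarrow> real"
  assumes f: "integrable (leb L) f" and ab: "0 \<le> a" "b \<le> L"
  shows "(LINT x|leb L. f x * indicator {a<..<b} x) = integral {a..b} f"
proof -
  have "(LINT x|leb L. f x * indicator {a<..<b} x) = integral {0..L} (\<lambda>x. f x * indicator {a<..<b} x)"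
    using f by (intro integral_leb integrable_leb_mult_indicator) auto
  also have "\<dots> = integral {0..L} (\<lambda>x. if x \<in> {a<..<b} then f x else 0)"
    by (intro arg_cong[where f = "integral _"]) (auto simp: indicator_def)
  also have "\<dots> = integral ({0..L} \<inter> {a<..<b}) f"
    by (simp only: Henstock_Kurzweil_Integration.integral_restrict_Int Int_commute)
  also have "{0..L} \<inter> {a<..<b} = {a<..<b}"
    using ab by auto
  finally show ?thesis by (simp add: integral_open_interval_real)
qed

text \<open>Bumps converge boundedly to the indicator of an open subinterval, so \<open>f\<close>
  has integral zero over every subinterval. Lebesgue differentiation then yields
  \<open>f = 0\<close> almost everywhere.\<close>

lemma fundamental_lemma_variations:
  assumes f: "integrable (leb L) f"
    and zero: "\<And>\<phi>. test_function L \<phi> \<Longrightarrow> (LINT x|leb L. f x * \<phi> x) = 0"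
  shows "AE x in leb L. f x = 0"
proof -
  have int0: "integral {a..b} f = 0" if ab: "0 \<le> a" "b \<le> L" for a b
  proof -
    \<comment> \<open>The index \<open>Suc n\<close> avoids \<open>n = 0\<close>, for which the bump
      is not covered by \<open>test_function_bump\<close>.\<close>
    have "(\<lambda>n. LINT x|leb L. f x * bump a b (Suc n) x) \<longlonglongrightarrow> (LINT x|leb L. f x * indicator {a<..<b} x)"
    proof (rule integral_dominated_convergence[where w = "\<lambda>x. \<bar>f x\<bar>"])
      show "(\<lambda>x. f x * indicat_real {a<..<b} x) \<in> borel_measurable (leb L)"
        using f by (intro borel_measurable_integrable integrable_leb_mult_indicator) auto
      show "(\<lambda>x. f x * bump a b (Suc n) x) \<in> borel_measurable (leb L)" for n
        using integrable_mult_continuous[OF f continuous_on_test_function[OF test_function_bump[OF ab, of "Suc n"]]]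
        by auto
      show "integrable (leb L) (\<lambda>x. \<bar>f x\<bar>)" using f by simp
      show "AE x in leb L. (\<lambda>n. f x * bump a b (Suc n) x) \<longlonglongrightarrow> f x * indicat_real {a<..<b} x"
        using bump_tendsto_indicator by (intro AE_I2 tendsto_intros LIMSEQ_Suc)
      show "AE x in leb L. norm (f x * bump a b (Suc n) x) \<le> \<bar>f x\<bar>" for n
        using abs_bump_le_1 by (intro AE_I2) (auto simp: abs_mult intro!: mult_left_le)
    qed
    moreover have "(LINT x|leb L. f x * bump a b (Suc n) x) = 0" for n
      using zero test_function_bump[OF ab] by simp
    ultimately have "(LINT x|leb L. f x * indicator {a<..<b} x) = 0"
      by (simp add: LIMSEQ_const_iff)
    then show ?thesis using integral_leb_mult_indicator[OF f ab] by simp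
  qed
  \<comment> \<open>Extension by zero: the differentiation theorem is applied to a function that is
    integrable on every box of the line.\<close>
  define F where "F x = (if x \<in> {0<..<L} then f x else 0)" for x
  have "F integrable_on UNIV"
    using integrable_on_lebesgue_on[OF f] unfolding F_def
    by (subst Henstock_Kurzweil_Integration.integrable_restrict_UNIV) auto
  then have "F integrable_on cbox a b" for a b
    by (rule integrable_on_subcbox) auto
  then obtain N where N: "negligible N" and
    lim: "\<And>x e. x \<notin> N \<Longrightarrow> 0 < e \<Longrightarrow>
      \<exists>d>0. \<forall>h. 0 < h \<and> h < d \<longrightarrow> norm (integral (cbox x (x + h *\<^sub>R One)) F /\<^sub>R h ^ DIM(real) - F x) < e"
    using integrable_ccontinuous_explicit[of F] by blast
  have "f x = 0" if x: "x \<notin> N" "0 < x" "x < L" for x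
  proof (rule ccontr)
    assume "f x \<noteq> 0"
    then obtain d where d: "d > 0"
      "\<And>h. 0 < h \<Longrightarrow> h < d \<Longrightarrow> norm (integral (cbox x (x + h *\<^sub>R One)) F /\<^sub>R h ^ DIM(real) - F x) < \<bar>f x\<bar>"
      using lim[OF x(1), of "\<bar>f x\<bar>"] by auto
    \<comment> \<open>With this \<open>h\<close> the interval \<open>{x..x + h}\<close> stays inside
      (0,L), where \<open>F\<close> agrees with \<open>f\<close> and has mean zero. But the mean
      would have to be closer to \<open>f x\<close> than \<open>\<bar>f x\<bar>\<close>.\<close>
    define h where "h = min (d / 2) ((L - x) / 2)"
    have h: "0 < h" "h < d" "x + h < L"
      using d(1) x by (auto simp: h_def min_def field_simps)
    have "integral {x..x + h} F = integral {x..x + h} f"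
      by (rule integral_cong) (use h x in \<open>auto simp: F_def\<close>)
    also have "\<dots> = 0" using x h by (intro int0) auto
    finally show False using d(2)[OF h(1,2)] x by (simp add: F_def)
  qed
  moreover have "AE x in lebesgue. x \<notin> N"
    using N by (intro AE_not_in) (simp add: negligible_iff_null_sets)
  ultimately show ?thesis
    unfolding AE_leb_iff by (auto elim: eventually_mono)
qed

lemma test_function_diff_scaled:
  assumes "test_function L \<phi>" "test_function L \<psi>"
  shows "test_function L (\<lambda>x. \<phi> x - c * \<psi> x)"
proof -
  have "closure {x. \<phi> x - c * \<psi> x \<noteq> 0} \<subseteq> closure ({x. \<phi> x \<noteq> 0} \<union> {x. \<psi> x \<noteq> 0})"
    by (rule closure_mono) auto
  moreover have "(\<lambda>x. \<phi> x - c * \<psi> x) C1_differentiable_on UNIV"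
    using assms unfolding test_function_def
    by (intro C1_differentiable_on_diff C1_differentiable_on_mult C1_differentiable_on_const) auto
  ultimately show ?thesis
    using assms by (auto simp: test_function_def closure_Un)
qed

lemma integrable_test_function: "test_function L \<phi> \<Longrightarrow> integrable (leb L) \<phi>"
  by (intro integrable_leb_continuous continuous_on_test_function)

lemma integral_deriv_test_function:
  assumes "test_function L \<phi>" "a \<le> b"
  shows "integral {a..b} (deriv \<phi>) = \<phi> b - \<phi> a"
proof (rule integral_unique, rule fundamental_theorem_of_calculus[OF assms(2)])
  show "(\<phi> has_vector_derivative deriv \<phi> x) (at x within {a..b})" for x
    using test_function_has_deriv[OF assms(1), of x]
    by (simp add: has_real_derivative_iff_has_vector_derivative has_vector_derivative_at_within)
qed

text \<open>The antiderivative vanishing at 0 is constant on either side of the support of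
  \<open>\<psi>\<close>. On the left the constant is its value at 0, on the right its value at
  \<open>L\<close>, which is the integral of \<open>\<psi>\<close>; hence its support is compact
  too.\<close>

lemma test_function_antiderivative:
  assumes L: "0 < L" and \<psi>: "test_function L \<psi>" and mean: "(LINT x|leb L. \<psi> x) = 0"
  obtains \<phi> where "test_function L \<phi>" "deriv \<phi> = \<psi>"
proof -
  have cont: "continuous_on S \<psi>" for S using continuous_on_test_function[OF \<psi>] .
  have "isCont \<psi> x" for x
    using cont[of UNIV] by (simp add: continuous_on_eq_continuous_at)
  then obtain F where F: "\<And>x. (F has_vector_derivative \<psi> x) (at x)"
    using einterval_antiderivative[of "-\<infinity>" "\<infinity>" \<psi>] by auto
  define \<phi> where "\<phi> x = F x - F 0" for x
  have \<phi>: "(\<phi> has_real_derivative \<psi> x) (at x)" for x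
    unfolding \<phi>_def using F[of x]
    by (auto simp: has_real_derivative_iff_has_vector_derivative[symmetric] intro!: derivative_eq_intros)
  \<comment> \<open>The support is compact inside the open interval, so its extreme points leave a
    gap at both ends. For an empty support the midpoint serves as both bounds.\<close>
  obtain a b where ab: "0 < a" "b < L" "closure {x. \<psi> x \<noteq> 0} \<subseteq> {a..b}"
  proof (cases "closure {x. \<psi> x \<noteq> 0} = {}")
    case True
    then show ?thesis using L by (intro that[of "L/2" "L/2"]) auto
  next
    case False
    have sub: "closure {x. \<psi> x \<noteq> 0} \<subseteq> {0<..<L}"
      using \<psi> by (simp add: test_function_def)
    then have "bounded (closure {x. \<psi> x \<noteq> 0})"
      by (rule bounded_subset[rotated]) (metis bounded_box box_real(1))
    then have comp: "compact (closure {x. \<psi> x \<noteq> 0})"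
      by (simp add: compact_eq_bounded_closed)
    obtain a b where "a \<in> closure {x. \<psi> x \<noteq> 0}" "b \<in> closure {x. \<psi> x \<noteq> 0}"
      "closure {x. \<psi> x \<noteq> 0} \<subseteq> {a..b}"
      using compact_attains_inf[OF comp False] compact_attains_sup[OF comp False]
      by (metis atLeastAtMost_iff subsetI)
    then show ?thesis using sub by (intro that[of a b]) auto
  qed
  have zero: "\<psi> x = 0" if "x < a \<or> b < x" for x
    using that ab(3) closure_subset[of "{x. \<psi> x \<noteq> 0}"] by fastforce
  have left: "\<phi> x = 0" if "x < a" for x
  proof -
    have "\<exists>c. \<forall>x\<in>{..<a}. \<phi> x = c"
      using \<phi> zero by (intro has_field_derivative_zero_constant)
        (auto intro: has_field_derivative_at_within, metis has_field_derivative_at_within)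
    then show ?thesis using that ab(1) by (metis \<phi>_def cancel_comm_monoid_add_class.diff_cancel lessThan_iff)
  qed
  have "\<phi> L - \<phi> 0 = integral {0..L} \<psi>"
    using F L by (intro integral_unique[symmetric] fundamental_theorem_of_calculus)
      (auto simp: has_real_derivative_iff_has_vector_derivative[symmetric] intro: \<phi> has_field_derivative_at_within)
  also have "\<dots> = 0"
    using mean integral_leb[OF integrable_test_function[OF \<psi>]] by simp
  finally have "\<phi> L = 0" by (simp add: \<phi>_def)
  have right: "\<phi> x = 0" if "b < x" for x
  proof -
    have "\<exists>c. \<forall>x\<in>{b<..}. \<phi> x = c"
      using \<phi> zero by (intro has_field_derivative_zero_constant)
        (auto intro: has_field_derivative_at_within, metis has_field_derivative_at_within)
    then show ?thesis using that ab(2) \<open>\<phi> L = 0\<close> by (metis greaterThan_iff)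
  qed
  have "{x. \<phi> x \<noteq> 0} \<subseteq> {a..b}"
    using left right by (auto simp: not_less[symmetric])
  then have "closure {x. \<phi> x \<noteq> 0} \<subseteq> {a..b}"
    by (rule closure_minimal) auto
  moreover have "\<phi> C1_differentiable_on UNIV"
    using \<phi> cont unfolding C1_differentiable_on_def has_real_derivative_iff_has_vector_derivative
    by blast
  ultimately have "test_function L \<phi>"
    using ab by (auto simp: test_function_def)
  moreover have "deriv \<phi> = \<psi>" using \<phi> by (intro ext DERIV_imp_deriv)
  ultimately show ?thesis by (rule that)
qed

text \<open>Subtracting a multiple of one fixed test function of nonzero mean turns any test function
  into the derivative of a test function.\<close>

lemma du_Bois_Reymond:
  assumes L: "0 < L" and h: "integrable (leb L) h"
    and zero: "\<And>\<phi>. test_function L \<phi> \<Longrightarrow> (LINT x|leb L. h x * deriv \<phi> x) = 0"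
  obtains c where "AE x in leb L. h x = c"
proof -
  obtain \<psi>0 where \<psi>0: "test_function L \<psi>0" "(LINT x|leb L. \<psi>0 x) \<noteq> 0"
  proof (rule ccontr)
    \<comment> \<open>If every test function had mean zero, the fundamental lemma would make the
      constant 1 vanish almost everywhere.\<close>
    assume "\<not> thesis"
    then have "(LINT x|leb L. 1 * \<phi> x) = 0" if "test_function L \<phi>" for \<phi>
      using that \<open>\<And>\<psi>0. \<lbrakk>test_function L \<psi>0; (LINT x|leb L. \<psi>0 x) \<noteq> 0\<rbrakk> \<Longrightarrow> thesis\<close> by auto
    then have "AE x in leb L. (1::real) = 0"
      using integrable_leb_continuous[of L "\<lambda>_. 1"] by (intro fundamental_lemma_variations) auto
    then show False
      using AE_leb_eq_imp_eq[OF L, of "\<lambda>_. 1" 0 0] L by auto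
  qed
  \<comment> \<open>If \<open>h\<close> is constant, testing with \<open>\<psi>0\<close> forces this
    value.\<close>
  define c where "c = (LINT x|leb L. h x * \<psi>0 x) / (LINT x|leb L. \<psi>0 x)"
  note int = integrable_mult_continuous[OF h continuous_on_test_function]
  have "AE x in leb L. h x - c = 0"
  proof (rule fundamental_lemma_variations)
    show "integrable (leb L) (\<lambda>x. h x - c)"
      using h integrable_leb_continuous[of L "\<lambda>_. c"] by auto
    fix \<psi> assume \<psi>: "test_function L \<psi>"
    define k where "k = (LINT x|leb L. \<psi> x) / (LINT x|leb L. \<psi>0 x)"
    have "(LINT x|leb L. \<psi> x - k * \<psi>0 x) = 0"
      using integrable_test_function[OF \<psi>] integrable_test_function[OF \<psi>0(1)] \<psi>0(2)
      by (simp add: k_def)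
    then obtain \<phi> where \<phi>: "test_function L \<phi>" "deriv \<phi> = (\<lambda>x. \<psi> x - k * \<psi>0 x)"
      using test_function_antiderivative[OF L test_function_diff_scaled[OF \<psi> \<psi>0(1)]] by metis
    have "0 = (LINT x|leb L. h x * \<psi> x - k * (h x * \<psi>0 x))"
      using zero[OF \<phi>(1)] by (simp add: \<phi>(2) algebra_simps)
    also have "\<dots> = (LINT x|leb L. h x * \<psi> x) - k * (LINT x|leb L. h x * \<psi>0 x)"
      using int[OF \<psi>] int[OF \<psi>0(1)] by (subst Bochner_Integration.integral_diff) auto
    also have "\<dots> = (LINT x|leb L. h x * \<psi> x) - c * (LINT x|leb L. \<psi> x)"
      by (simp add: k_def c_def)
    also have "\<dots> = (LINT x|leb L. h x * \<psi> x - c * \<psi> x)"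
      using int[OF \<psi>] integrable_test_function[OF \<psi>] by (subst Bochner_Integration.integral_diff) auto
    finally show "(LINT x|leb L. (h x - c) * \<psi> x) = 0"
      by (simp add: algebra_simps)
  qed
  then show ?thesis by (intro that[of c]) auto
qed

subsection \<open>Weak derivatives on an interval\<close>

text \<open>Integration by parts through Fubini: \<open>deriv \<phi> x * g y\<close> is integrated
  over the triangle \<open>y < x\<close> in both orders. The inner integral in \<open>x\<close> is
  \<open>\<phi> L - \<phi> y = - \<phi> y\<close>.\<close>

lemma integral_antiderivative_mult_deriv:
  assumes L: "0 < L" and g: "integrable (leb L) g" and \<phi>: "test_function L \<phi>"
  shows "(LINT x|leb L. integral {0..x} g * deriv \<phi> x) = - (LINT x|leb L. g x * \<phi> x)"
proof -
  interpret finite_measure "leb L" by (rule finite_measure_leb)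
  interpret P: pair_sigma_finite "leb L" "leb L" ..
  let ?I = "\<lambda>x y. indicator {p. snd p < fst p} (x, y) :: real"
  have \<phi>': "integrable (leb L) (deriv \<phi>)"
    using continuous_on_deriv_test_function[OF \<phi>] by (rule integrable_leb_continuous)
  have [measurable]: "g \<in> borel_measurable (leb L)" "deriv \<phi> \<in> borel_measurable (leb L)"
    using g \<phi>' by auto
  have prod: "integrable (leb L \<Otimes>\<^sub>M leb L) (\<lambda>(x, y). deriv \<phi> x * g y)"
    using g \<phi>' by (intro P.Fubini_integrable) (auto simp: abs_mult)
  \<comment> \<open>The identity on pairs is measurable from the product of the Lebesgue
    sigma-algebras to the Borel sets of the plane, so the indicator of the open triangle is
    measurable for that product.\<close>
  have id2: "(\<lambda>p. (fst p, snd p)) \<in> borel_measurable (leb L \<Otimes>\<^sub>M leb L)"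
    by (intro borel_measurable_Pair measurable_compose[OF measurable_fst id_measurable_leb]
        measurable_compose[OF measurable_snd id_measurable_leb])
  have "{p :: real \<times> real. snd p < fst p} \<in> sets borel"
    by (intro borel_open open_Collect_less continuous_intros)
  then have [measurable]: "(\<lambda>p. indicator {p. snd p < fst p} p :: real) \<in> borel_measurable (leb L \<Otimes>\<^sub>M leb L)"
    using measurable_compose[OF id2 borel_measurable_indicator] by simp
  have "integrable (leb L \<Otimes>\<^sub>M leb L) (\<lambda>p. deriv \<phi> (fst p) * g (snd p) * indicator {p. snd p < fst p} p)"
  proof (rule Bochner_Integration.integrable_bound[OF prod])
    show "(\<lambda>p. deriv \<phi> (fst p) * g (snd p) * indicator {p. snd p < fst p} p)
        \<in> borel_measurable (leb L \<Otimes>\<^sub>M leb L)"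
      by measurable
  qed (auto simp: indicator_def split: prod.split)
  then have int: "integrable (leb L \<Otimes>\<^sub>M leb L) (\<lambda>(x, y). deriv \<phi> x * g y * ?I x y)"
    by (simp add: case_prod_unfold)
  have "(LINT x|leb L. integral {0..x} g * deriv \<phi> x) =
      (LINT x|leb L. LINT y|leb L. deriv \<phi> x * g y * ?I x y)"
  proof (rule Bochner_Integration.integral_cong)
    fix x assume "x \<in> space (leb L)"
    then have x: "0 < x" "x < L" by auto
    have "(LINT y|leb L. deriv \<phi> x * g y * ?I x y) = (LINT y|leb L. deriv \<phi> x * (g y * indicator {0<..<x} y))"
      by (rule Bochner_Integration.integral_cong) (auto simp: indicator_def)
    also have "\<dots> = deriv \<phi> x * integral {0..x} g"
      using integral_leb_mult_indicator[OF g, of 0 x] x by simp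
    finally show "integral {0..x} g * deriv \<phi> x = (LINT y|leb L. deriv \<phi> x * g y * ?I x y)"
      by simp
  qed simp
  also have "\<dots> = (LINT y|leb L. LINT x|leb L. deriv \<phi> x * g y * ?I x y)"
    using P.Fubini_integral[OF int] by simp
  also have "\<dots> = (LINT y|leb L. - (g y * \<phi> y))"
  proof (rule Bochner_Integration.integral_cong)
    fix y assume "y \<in> space (leb L)"
    then have y: "0 < y" "y < L" by auto
    have "(LINT x|leb L. deriv \<phi> x * g y * ?I x y) = (LINT x|leb L. g y * (deriv \<phi> x * indicator {y<..<L} x))"
      by (rule Bochner_Integration.integral_cong) (auto simp: indicator_def)
    also have "\<dots> = g y * integral {y..L} (deriv \<phi>)"
      using integral_leb_mult_indicator[OF \<phi>', of y L] y by simp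
    also have "\<dots> = - (g y * \<phi> y)"
      using y test_function_eq_0[OF \<phi>, of L] by (simp add: integral_deriv_test_function[OF \<phi>])
    finally show "(LINT x|leb L. deriv \<phi> x * g y * ?I x y) = - (g y * \<phi> y)" .
  qed simp
  finally show ?thesis by simp
qed

lemma L2_imp_integrable:
  assumes "L2 L f"
  shows "integrable (leb L) f"
proof (rule finite_measure.square_integrable_imp_integrable[OF finite_measure_leb])
qed (use assms in \<open>auto simp: L2_def\<close>)

lemma L2_continuous: "continuous_on {0..L} f \<Longrightarrow> L2 L f"
  unfolding L2_def using integrable_leb_continuous[of L f] integrable_leb_continuous[of L "\<lambda>x. (f x)\<^sup>2"]
  by (auto intro: continuous_intros)

text \<open>The difference of \<open>v\<close> and the antiderivative of \<open>g\<close> integrates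
  to zero against every \<open>deriv \<phi>\<close>, so it is constant almost everywhere by
  \<open>du_Bois_Reymond\<close>. The representative is that constant plus the
  antiderivative.\<close>

lemma weak_deriv_imp_continuous_representative:
  assumes L: "0 < L" and v: "L2 L v" and g: "has_weak_deriv L v g"
  obtains w where "continuous_on {0..L} w" "AE x in leb L. v x = w x"
    "\<And>a b. 0 \<le> a \<Longrightarrow> a \<le> b \<Longrightarrow> b \<le> L \<Longrightarrow> w b - w a = integral {a..b} g"
proof -
  have int_g: "integrable (leb L) g" and int_v: "integrable (leb L) v"
    using g v by (auto simp: has_weak_deriv_def intro: L2_imp_integrable)
  note g_on = integrable_leb_imp_integrable_on[OF int_g]
  have cont_G: "continuous_on {0..L} (\<lambda>x. integral {0..x} g)"
    using g_on by (rule indefinite_integral_continuous_1)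
  note int_G = integrable_leb_continuous[OF cont_G]
  obtain c where c: "AE x in leb L. v x - integral {0..x} g = c"
  proof (rule du_Bois_Reymond[OF L, of "\<lambda>x. v x - integral {0..x} g"])
    show "integrable (leb L) (\<lambda>x. v x - integral {0..x} g)"
      using int_v int_G by simp
    fix \<phi> assume \<phi>: "test_function L \<phi>"
    note \<phi>' = continuous_on_deriv_test_function[OF \<phi>]
    have "(LINT x|leb L. (v x - integral {0..x} g) * deriv \<phi> x)
        = (LINT x|leb L. v x * deriv \<phi> x) - (LINT x|leb L. integral {0..x} g * deriv \<phi> x)"
      unfolding left_diff_distrib
      using integrable_mult_continuous[OF int_v \<phi>'] integrable_mult_continuous[OF int_G \<phi>'] by simp
    also have "\<dots> = 0"
      using g \<phi> integral_antiderivative_mult_deriv[OF L int_g \<phi>] by (simp add: has_weak_deriv_def)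
    finally show "(LINT x|leb L. (v x - integral {0..x} g) * deriv \<phi> x) = 0" .
  qed
  show ?thesis
  proof (rule that[of "\<lambda>x. c + integral {0..x} g"])
    show "continuous_on {0..L} (\<lambda>x. c + integral {0..x} g)"
      using cont_G by (intro continuous_intros)
    show "AE x in leb L. v x = c + integral {0..x} g" using c by eventually_elim simp
    fix a b assume ab: "0 \<le> a" "a \<le> b" "b \<le> L"
    have "g integrable_on {0..b}"
      using g_on by (rule integrable_on_subinterval) (use ab in auto)
    then have "integral {0..a} g + integral {a..b} g = integral {0..b} g"
      using ab by (intro Henstock_Kurzweil_Integration.integral_combine) auto
    then show "c + integral {0..b} g - (c + integral {0..a} g) = integral {a..b} g" by simp
  qed
qed

text \<open>The converse direction, which exhibits explicit members of \<open>H1 L\<close>. The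
  constant drops out because the integral of \<open>deriv \<phi>\<close> vanishes.\<close>

lemma has_weak_deriv_antiderivative:
  assumes L: "0 < L" and g: "L2 L g"
  shows "has_weak_deriv L (\<lambda>x. c + integral {0..x} g) g"
  unfolding has_weak_deriv_def
proof (intro conjI allI impI)
  fix \<phi> assume \<phi>: "test_function L \<phi>"
  note \<phi>' = continuous_on_deriv_test_function[OF \<phi>]
  have "continuous_on {0..L} (\<lambda>x. integral {0..x} g)"
    using L2_imp_integrable[OF g] by (intro indefinite_integral_continuous_1 integrable_leb_imp_integrable_on)
  note int_G = integrable_leb_continuous[OF this]
  have "(LINT x|leb L. deriv \<phi> x) = 0"
    using L test_function_eq_0[OF \<phi>]
    by (simp add: integral_leb[OF integrable_leb_continuous[OF \<phi>']] integral_deriv_test_function[OF \<phi>])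
  then have "(LINT x|leb L. c * deriv \<phi> x + integral {0..x} g * deriv \<phi> x) = (LINT x|leb L. integral {0..x} g * deriv \<phi> x)"
    using integrable_mult_continuous[OF int_G \<phi>'] integrable_leb_continuous[OF \<phi>'] by simp
  then show "(LINT x|leb L. (c + integral {0..x} g) * deriv \<phi> x) = - (LINT x|leb L. g x * \<phi> x)"
    using integral_antiderivative_mult_deriv[OF L L2_imp_integrable[OF g] \<phi>]
    by (simp add: distrib_right)
qed (fact g)

lemma has_weak_deriv_unique:
  assumes "has_weak_deriv L v g" "has_weak_deriv L v h"
  shows "AE x in leb L. g x = h x"
proof -
  have int: "integrable (leb L) g" "integrable (leb L) h"
    using assms by (auto simp: has_weak_deriv_def intro: L2_imp_integrable)
  have "AE x in leb L. g x - h x = 0"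
  proof (rule fundamental_lemma_variations)
    show "integrable (leb L) (\<lambda>x. g x - h x)" using int by simp
    fix \<phi> assume \<phi>: "test_function L \<phi>"
    have "(LINT x|leb L. g x * \<phi> x) = (LINT x|leb L. h x * \<phi> x)"
      using assms \<phi> by (auto simp: has_weak_deriv_def)
    then show "(LINT x|leb L. (g x - h x) * \<phi> x) = 0"
      using int[THEN integrable_mult_continuous, OF continuous_on_test_function[OF \<phi>]]
      by (simp add: left_diff_distrib)
  qed
  then show ?thesis by simp
qed

text \<open>An equality of predicates makes the choice in \<open>weak_deriv\<close> select the very
  same function for \<open>v\<close> and \<open>w\<close>, not just one that agrees almost
  everywhere.\<close>

lemma has_weak_deriv_cong_AE:
  assumes "v \<in> borel_measurable (leb L)" "w \<in> borel_measurable (leb L)" "AE x in leb L. v x = w x"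
  shows "has_weak_deriv L v = has_weak_deriv L w"
proof -
  have "(LINT x|leb L. v x * deriv \<phi> x) = (LINT x|leb L. w x * deriv \<phi> x)" if "test_function L \<phi>" for \<phi>
  proof (rule integral_cong_AE)
    have "deriv \<phi> \<in> borel_measurable (leb L)"
      using integrable_leb_continuous[OF continuous_on_deriv_test_function[OF that]] by auto
    then show "(\<lambda>x. v x * deriv \<phi> x) \<in> borel_measurable (leb L)" "(\<lambda>x. w x * deriv \<phi> x) \<in> borel_measurable (leb L)"
      using assms by (auto intro: borel_measurable_times)
    show "AE x in leb L. v x * deriv \<phi> x = w x * deriv \<phi> x"
      using assms(3) by eventually_elim simp
  qed
  then show ?thesis unfolding has_weak_deriv_def fun_eq_iff by auto
qed

lemma has_weak_deriv_add_const:
  assumes "0 < L" "integrable (leb L) v"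
  shows "has_weak_deriv L (\<lambda>x. v x + k) = has_weak_deriv L v"
proof -
  have "(LINT x|leb L. (v x + k) * deriv \<phi> x) = (LINT x|leb L. v x * deriv \<phi> x)"
    if \<phi>: "test_function L \<phi>" for \<phi>
  proof -
    note \<phi>' = continuous_on_deriv_test_function[OF \<phi>]
    have "(LINT x|leb L. deriv \<phi> x) = 0"
      using assms(1) test_function_eq_0[OF \<phi>]
      by (simp add: integral_leb[OF integrable_leb_continuous[OF \<phi>']] integral_deriv_test_function[OF \<phi>])
    then show ?thesis
      using integrable_mult_continuous[OF assms(2) \<phi>'] integrable_leb_continuous[OF \<phi>']
      by (simp add: distrib_right)
  qed
  then show ?thesis unfolding has_weak_deriv_def fun_eq_iff by auto
qed

lemma has_weak_deriv_weak_deriv: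
  assumes "v \<in> H1 L"
  shows "has_weak_deriv L v (weak_deriv L v)"
  using assms unfolding H1_def weak_deriv_def by (simp add: someI_ex)

subsection \<open>The constants \<open>\<beta>\<^sub>p\<close> and weighted integrals\<close>

text \<open>\<open>Lp_norm\<close> applies \<open>real_of_ereal\<close>, which sends infinite values
  to 0, so the essential supremum must first be shown finite. It is bounded above by compactness,
  and it is not \<open>-\<infinity>\<close> because (0,L) has positive measure.\<close>

lemma abs_le_Lp_norm_infinity:
  assumes L: "0 < L" and f: "continuous_on {0..L} f" and x: "x \<in> {0..L}"
  shows "\<bar>f x\<bar> \<le> Lp_norm L \<infinity> f"
proof -
  define S where "S = esssup (leb L) (\<lambda>x. ereal \<bar>f x\<bar>)"
  have ae: "AE x in leb L. ereal \<bar>f x\<bar> \<le> S" unfolding S_def by (rule esssup_AE)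
  have cont: "continuous_on {0..L} (\<lambda>x. \<bar>f x\<bar>)" using f by (intro continuous_intros)
  have "compact ((\<lambda>x. \<bar>f x\<bar>) ` {0..L})" using cont by (intro compact_continuous_image) auto
  then obtain C where C: "\<And>x. x \<in> {0..L} \<Longrightarrow> \<bar>f x\<bar> \<le> C"
    using L compact_attains_sup[of "(\<lambda>x. \<bar>f x\<bar>) ` {0..L}"] by force
  have "S \<le> ereal C"
    unfolding S_def
  proof (rule esssup_I)
    show "(\<lambda>x. ereal \<bar>f x\<bar>) \<in> borel_measurable (leb L)"
      using integrable_leb_continuous[OF cont] by (intro borel_measurable_ereal) auto
  qed (auto intro!: AE_leb_I C)
  moreover have "S \<noteq> -\<infinity>"
  proof
    assume "S = -\<infinity>"
    then have "AE x in leb L. (0::real) = 1" using ae by auto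
    then show False using AE_leb_eq_imp_eq[OF L, of "\<lambda>_. 0" 1 0] L by auto
  qed
  ultimately obtain s where s: "S = ereal s" by (cases S) auto
  have "AE x in leb L. \<bar>f x\<bar> \<le> s" using ae by (simp add: s)
  then have "\<bar>f x\<bar> \<le> s" by (rule AE_leb_le_imp_le[OF L cont _ x])
  then show ?thesis by (simp add: Lp_norm_def flip: S_def) (simp add: s)
qed

lemma I_functional_nonneg: "0 \<le> I_functional L p v"
  unfolding I_functional_def Let_def by auto

lemma beta_le_I_functional:
  assumes "v \<in> X_space L p" "\<not> (AE x in leb L. v x = 0)"
  shows "beta L p \<le> I_functional L p v"
  unfolding beta_def
  by (rule cInf_lower) (use assms in \<open>auto intro!: bdd_belowI[of _ 0] I_functional_nonneg\<close>)

lemma continuous_not_AE_0: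
  fixes v :: "real \<Rightarrow> real"
  assumes "0 < L" "continuous_on {0..L} v" "x \<in> {0..L}" "v x \<noteq> 0"
  shows "\<not> (AE x in leb L. v x = 0)"
  using AE_leb_eq_imp_eq[OF assms(1,2), where c = 0 and x = x] assms(3,4) by blast

lemma integral_leb_const: "0 < L \<Longrightarrow> (LINT x|leb L. c) = c * L"
  using integral_leb[OF integrable_leb_continuous, of L "\<lambda>_. c"] by simp

text \<open>The competitor is \<open>1 - 2x/L\<close>.\<close>

lemma beta_1_le:
  assumes L: "0 < L"
  shows "beta L 1 \<le> 4 / L"
proof -
  \<comment> \<open>Written as an antiderivative, the competitor has its weak derivative at
    once.\<close>
  define v :: "real \<Rightarrow> real" where "v x = 1 + integral {0..x} (\<lambda>_. - 2 / L)" for x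
  have v: "v x = 1 - 2 / L * x" if "x \<in> {0..L}" for x
    using that by (simp add: v_def)
  have "L2 L (\<lambda>_. - 2 / L)" by (intro L2_continuous continuous_intros)
  from has_weak_deriv_antiderivative[OF L this, of 1]
  have wd: "has_weak_deriv L v (\<lambda>_. - 2 / L)" unfolding v_def .
  have "continuous_on {0..L} (\<lambda>x. 1 - 2 / L * x)" by (intro continuous_intros)
  then have cont: "continuous_on {0..L} v" by (rule continuous_on_eq) (simp add: v)
  have H1: "v \<in> H1 L" using L2_continuous[OF cont] wd by (auto simp: H1_def)
  have "Sup (v ` {0..L}) = 1"
    by (rule cSup_eq_maximum) (use L in \<open>force simp: v image_iff\<close>)+
  moreover have "Inf (v ` {0..L}) = -1"
    by (rule cInf_eq_minimum) (use L in \<open>force simp: v image_iff field_simps\<close>)+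
  ultimately have X: "v \<in> X_space L 1"
    using H1 cont by (simp add: X_space_def)
  have "v 0 = 1" using v[of 0] L by simp
  then have "beta L 1 \<le> I_functional L 1 v"
    using X continuous_not_AE_0[OF L cont, of 0] L by (intro beta_le_I_functional) auto
  also have "\<dots> = (LINT x|leb L. (weak_deriv L v x)\<^sup>2) / (Lp_norm L \<infinity> v)\<^sup>2"
    by (simp add: I_functional_def)
  also have "(LINT x|leb L. (weak_deriv L v x)\<^sup>2) = (LINT x|leb L. (- 2 / L)\<^sup>2)"
  proof (rule integral_cong_AE)
    show "AE x in leb L. (weak_deriv L v x)\<^sup>2 = (- 2 / L)\<^sup>2"
      using has_weak_deriv_unique[OF has_weak_deriv_weak_deriv[OF H1] wd] by eventually_elim simp
  qed (use has_weak_deriv_weak_deriv[OF H1] in \<open>auto simp: has_weak_deriv_def L2_def\<close>)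
  also have "\<dots> = 4 / L" unfolding integral_leb_const[OF L] using L by (simp add: power2_eq_square)
  also have "4 / L / (Lp_norm L \<infinity> v)\<^sup>2 \<le> 4 / L / 1"
  proof (rule divide_left_mono)
    have "1 \<le> Lp_norm L \<infinity> v"
      using abs_le_Lp_norm_infinity[OF L cont, of 0] L \<open>v 0 = 1\<close> by simp
    then show "1 \<le> (Lp_norm L \<infinity> v)\<^sup>2" by simp
    then show "0 < (Lp_norm L \<infinity> v)\<^sup>2 * 1" by linarith
  qed (use L in simp)
  finally show ?thesis by simp
qed

text \<open>Cauchy-Schwarz against the indicator of (x,y): the integral of the square of
  \<open>g\<close> minus \<open>m\<close> times that indicator is nonnegative, and the mean value
  \<open>m\<close> of \<open>g\<close> is the optimal multiple.\<close>

lemma square_integral_le: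
  assumes g: "L2 L g" and xy: "0 \<le> x" "x \<le> y" "y \<le> L"
  shows "(integral {x..y} g)\<^sup>2 \<le> (y - x) * (LINT t|leb L. (g t)\<^sup>2)"
proof (cases "x = y")
  case False
  define m where "m = integral {x..y} g / (y - x)"
  have m: "m\<^sup>2 * (y - x) = m * integral {x..y} g" "(integral {x..y} g)\<^sup>2 / (y - x) = m * integral {x..y} g"
    using False by (simp_all add: m_def power2_eq_square)
  have int: "integrable (leb L) g" "integrable (leb L) (\<lambda>t. (g t)\<^sup>2)"
    using g L2_imp_integrable[OF g] by (auto simp: L2_def)
  have 1: "integrable (leb L) (\<lambda>_. 1 :: real)" by (intro integrable_leb_continuous continuous_intros)
  have "0 \<le> (LINT t|leb L. (g t - m * indicator {x<..<y} t)\<^sup>2)" by simp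
  also have "\<dots> = (LINT t|leb L. (g t)\<^sup>2 - 2 * m * (g t * indicator {x<..<y} t) + m\<^sup>2 * (1 * indicator {x<..<y} t))"
    by (rule Bochner_Integration.integral_cong) (auto simp: power2_eq_square algebra_simps indicator_def)
  also have "\<dots> = (LINT t|leb L. (g t)\<^sup>2) - 2 * m * (LINT t|leb L. g t * indicator {x<..<y} t)
      + m\<^sup>2 * (LINT t|leb L. 1 * indicator {x<..<y} t)"
    using int integrable_leb_mult_indicator[OF int(1), of "{x<..<y}"]
      integrable_leb_mult_indicator[OF 1, of "{x<..<y}"]
    by (subst Bochner_Integration.integral_add Bochner_Integration.integral_diff; simp)+
  also have "\<dots> = (LINT t|leb L. (g t)\<^sup>2) - 2 * m * integral {x..y} g + m\<^sup>2 * (y - x)"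
    using integral_leb_mult_indicator[OF int(1) xy(1,3)] integral_leb_mult_indicator[OF 1 xy(1,3)] xy by simp
  also have "\<dots> = (LINT t|leb L. (g t)\<^sup>2) - (integral {x..y} g)\<^sup>2 / (y - x)"
    by (simp add: m)
  finally show ?thesis using xy False by (simp add: field_simps)
qed simp

text \<open>A continuous \<open>v\<close> agrees everywhere with the representative given by its
  weak derivative, so its increments are integrals to which \<open>square_integral_le\<close>
  applies.\<close>

lemma square_increment_le:
  assumes L: "0 < L" and v: "v \<in> H1 L" "continuous_on {0..L} v"
    and x: "x \<in> {0..L}" and y: "y \<in> {0..L}"
  shows "(v y - v x)\<^sup>2 \<le> \<bar>y - x\<bar> * (LINT t|leb L. (weak_deriv L v t)\<^sup>2)"
proof -
  have v2: "L2 L v" and wd: "has_weak_deriv L v (weak_deriv L v)"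
    using v(1) has_weak_deriv_weak_deriv by (auto simp: H1_def)
  obtain w where w: "continuous_on {0..L} w" "AE x in leb L. v x = w x"
    "\<And>a b. 0 \<le> a \<Longrightarrow> a \<le> b \<Longrightarrow> b \<le> L \<Longrightarrow> w b - w a = integral {a..b} (weak_deriv L v)"
    using weak_deriv_imp_continuous_representative[OF L v2 wd] by blast
  have "v t = w t" if "t \<in> {0..L}" for t
    using AE_leb_eq_imp_eq[OF L, of "\<lambda>x. v x - w x" 0 t] v(2) w(1,2) that
    by (auto intro: continuous_intros)
  then have inc: "v b - v a = integral {a..b} (weak_deriv L v)" if "0 \<le> a" "a \<le> b" "b \<le> L" for a b
    using w(3)[OF that] that by auto
  have le: "(v b - v a)\<^sup>2 \<le> (b - a) * (LINT t|leb L. (weak_deriv L v t)\<^sup>2)" if "0 \<le> a" "a \<le> b" "b \<le> L" for a b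
    using square_integral_le[OF _ that] wd inc[OF that] by (simp add: has_weak_deriv_def)
  show ?thesis
  proof (cases "x \<le> y")
    case True
    then show ?thesis using le[of x y] x y by simp
  next
    case False
    then show ?thesis using le[of y x] x y by (simp add: power2_commute)
  qed
qed

section \<open>Weighted integrals of squares compared with the Dirichlet integral\<close>

lemma integral_leb_mono:
  fixes f g :: "real \<Rightarrow> real"
  assumes "continuous_on {0..L} f" "continuous_on {0..L} g" "\<And>x. x \<in> {0..L} \<Longrightarrow> f x \<le> g x"
  shows "(LINT x|leb L. f x) \<le> (LINT x|leb L. g x)"
  using assms by (intro integral_mono_AE integrable_leb_continuous AE_leb_I) auto

text \<open>Only \<open>beta L 1 \<le> 4 / L\<close> matters here. A mass of \<open>b\<^sup>+\<close> in the open interval must sit where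
  \<open>\<bar>v\<bar>\<close> is maximal, and then \<open>v\<close> travels between its extrema over a length smaller than \<open>L\<close>.\<close>

lemma weighted_integral_less_1:
  assumes L: "0 < L" and v: "v \<in> H1 L" "continuous_on {0..L} v"
    and ext: "Sup (v ` {0..L}) + Inf (v ` {0..L}) = 0"
    and nz: "x0 \<in> {0..L}" "v x0 \<noteq> 0"
    and b: "continuous_on {0..L} b" and le: "(LINT x|leb L. max (b x) 0) \<le> 4 / L"
  shows "(LINT x|leb L. b x * (v x)\<^sup>2) < (LINT x|leb L. (weak_deriv L v x)\<^sup>2)"
proof (rule ccontr)
  define D where "D = (LINT x|leb L. (weak_deriv L v x)\<^sup>2)"
  define M where "M = Sup (v ` {0..L})"
  assume "\<not> ?thesis"
  then have D: "D \<le> (LINT x|leb L. b x * (v x)\<^sup>2)" by (simp add: D_def)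
  have comp: "compact (v ` {0..L})" and ne: "v ` {0..L} \<noteq> {}"
    using v(2) L by (auto intro: compact_continuous_image)
  then have closed: "closed (v ` {0..L})" and bdd: "bdd_above (v ` {0..L})" "bdd_below (v ` {0..L})"
    by (auto simp: compact_eq_bounded_closed bounded_imp_bdd_above bounded_imp_bdd_below)
  obtain x1 where x1: "x1 \<in> {0..L}" "v x1 = M"
    using closed_contains_Sup[OF ne bdd(1) closed] by (auto simp: M_def)
  obtain x2 where x2: "x2 \<in> {0..L}" "v x2 = - M"
    using closed_contains_Inf[OF ne bdd(2) closed] ext by (auto simp: M_def)
  have bound: "\<bar>v x\<bar> \<le> M" if "x \<in> {0..L}" for x
    using cSup_upper[OF imageI[OF that] bdd(1)] cInf_lower[OF imageI[OF that] bdd(2)] ext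
    by (auto simp: M_def)
  have M: "0 < M" using bound[OF nz(1)] nz(2) by linarith
  have sq: "(v x)\<^sup>2 \<le> M\<^sup>2" if "x \<in> {0..L}" for x
    using bound[OF that] M by (simp add: abs_le_square_iff[symmetric])
  \<comment> \<open>Travelling between \<open>M\<close> and \<open>- M\<close> is an increment of
    size \<open>2 * M\<close>.\<close>
  have len: "4 * M\<^sup>2 \<le> \<bar>s - t\<bar> * D" if "s \<in> {0..L}" "t \<in> {0..L}" "v s = M \<and> v t = -M \<or> v s = -M \<and> v t = M" for s t
    using square_increment_le[OF L v that(2,1)] that(3) by (auto simp: D_def power2_eq_square)
  have "D \<ge> 0" by (simp add: D_def)
  have "4 * M\<^sup>2 \<le> L * D"
    using len[of x1 x2] x1 x2 mult_right_mono[of "\<bar>x1 - x2\<bar>" L D] \<open>D \<ge> 0\<close> by force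
  have cb: "continuous_on {0..L} (\<lambda>x. max (b x) 0)" using b by (intro continuous_intros)
  have c1: "continuous_on {0..L} (\<lambda>x. max (b x) 0 * (v x)\<^sup>2)"
    and c2: "continuous_on {0..L} (\<lambda>x. b x * (v x)\<^sup>2)"
    using b v(2) by (auto intro!: continuous_intros)
  note int = integrable_leb_continuous[OF cb] integrable_leb_continuous[OF c1]
  \<comment> \<open>The contrary assumption closes the chain from \<open>D\<close> through the
    weighted integrals with \<open>b\<close> and with its positive part, then \<open>M^2\<close>
    times the mass of that positive part, then \<open>4 * M^2 / L\<close>, back to \<open>D\<close>.
    All links are therefore equalities, and the integral in \<open>eq\<close> below is the defect of
    one of them.\<close>
  have 1: "(LINT x|leb L. b x * (v x)\<^sup>2) \<le> (LINT x|leb L. max (b x) 0 * (v x)\<^sup>2)"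
    by (rule integral_leb_mono[OF c2 c1]) (auto intro: mult_right_mono)
  have 2: "M\<^sup>2 * (LINT x|leb L. max (b x) 0) \<le> 4 * M\<^sup>2 / L"
    using mult_left_mono[OF le, of "M\<^sup>2"] by (simp add: algebra_simps)
  have 3: "4 * M\<^sup>2 / L \<le> D" using \<open>4 * M\<^sup>2 \<le> L * D\<close> L by (simp add: field_simps)
  have eq: "(LINT x|leb L. max (b x) 0 * (M\<^sup>2 - (v x)\<^sup>2))
      = M\<^sup>2 * (LINT x|leb L. max (b x) 0) - (LINT x|leb L. max (b x) 0 * (v x)\<^sup>2)"
    using int by (simp add: right_diff_distrib mult.commute)
  have nonneg: "AE x in leb L. 0 \<le> max (b x) 0 * (M\<^sup>2 - (v x)\<^sup>2)"
    using sq by (intro AE_leb_I mult_nonneg_nonneg) auto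
  have c3: "continuous_on {0..L} (\<lambda>x. max (b x) 0 * (M\<^sup>2 - (v x)\<^sup>2))"
    using b v(2) by (intro continuous_intros)
  have "(LINT x|leb L. max (b x) 0 * (M\<^sup>2 - (v x)\<^sup>2)) = 0"
    using integral_nonneg_AE[OF nonneg] eq D 1 2 3 by linarith
  then have ae: "AE x in leb L. max (b x) 0 * (M\<^sup>2 - (v x)\<^sup>2) = 0"
    using integral_nonneg_eq_0_iff_AE[OF integrable_leb_continuous[OF c3] nonneg] by simp
  have zero: "max (b x) 0 * (M\<^sup>2 - (v x)\<^sup>2) = 0" if "x \<in> {0..L}" for x
    by (rule AE_leb_eq_imp_eq[OF L c3 ae that])
  have "D = 4 * M\<^sup>2 / L"
    using integral_nonneg_AE[OF nonneg] eq D 1 2 3 by linarith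
  then have D_eq: "L * D = 4 * M\<^sup>2" using L by simp
  have "0 < 4 * M\<^sup>2 / L" using M L by simp
  then have pos: "0 < M\<^sup>2 * (LINT x|leb L. max (b x) 0)"
    using integral_nonneg_AE[OF nonneg] eq D 1 2 3 by linarith
  obtain t where t: "0 < t" "t < L" "0 < b t"
  proof (rule ccontr)
    assume "\<not> thesis"
    then have "AE x in leb L. max (b x) 0 = 0"
      using that by (intro AE_leb_I) force
    then have "(LINT x|leb L. max (b x) 0) = 0" by (rule integral_eq_zero_AE)
    then show False using pos by simp
  qed
  then have "v t = M \<or> v t = - M"
    using zero[of t] by (auto simp: power2_eq_iff)
  then obtain s where s: "s \<in> {0..L}" "v s = M \<and> v t = -M \<or> v s = -M \<and> v t = M"
    using x1 x2 by metis
  have "0 < L * D" unfolding D_eq using M by simp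
  then have "D > 0" using L by (simp add: zero_less_mult_iff)
  \<comment> \<open>Strict because \<open>t\<close> is interior; this contradicts
    \<open>len\<close>, as equality in the chain gave \<open>L * D = 4 * M^2\<close>.\<close>
  moreover have "\<bar>s - t\<bar> < L" using s(1) t by auto
  ultimately have "\<bar>s - t\<bar> * D < L * D" by simp
  then show False using len[OF s(1) _ s(2)] t D_eq by auto
qed

lemma continuous_on_abs_powr:
  fixes f :: "real \<Rightarrow> real"
  assumes "continuous_on S f" "0 < a"
  shows "continuous_on S (\<lambda>x. \<bar>f x\<bar> powr a)"
  using assms by (intro continuous_on_powr' continuous_intros) auto

text \<open>Young's inequality for \<open>f x / F\<close> and \<open>h x / N\<close>, integrated.
  Positive upper bounds \<open>F\<close> and \<open>N\<close> take the place of the norms, so that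
  the divisions stay meaningful when a norm vanishes.\<close>

lemma Holder_integral_leb:
  fixes f h :: "real \<Rightarrow> real"
  assumes f: "continuous_on {0..L} f" "\<And>x. 0 \<le> f x" and h: "continuous_on {0..L} h" "\<And>x. 0 \<le> h x"
    and q: "1 < q" "1 < r" "1 / q + 1 / r = 1" and pos: "0 < F" "0 < N"
    and F: "(LINT x|leb L. f x powr q) \<le> F powr q"
    and N: "(LINT x|leb L. h x powr r) \<le> N powr r"
  shows "(LINT x|leb L. f x * h x) \<le> F * N"
proof -
  have cf: "continuous_on {0..L} (\<lambda>x. f x powr q)" and ch: "continuous_on {0..L} (\<lambda>x. h x powr r)"
    using continuous_on_abs_powr[OF f(1), of q] continuous_on_abs_powr[OF h(1), of r] f h q by simp_all
  note int = integrable_leb_continuous[OF cf] integrable_leb_continuous[OF ch]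
  have cfh: "continuous_on {0..L} (\<lambda>x. f x * h x / (F * N))"
    using f h pos by (intro continuous_intros) auto
  have "(LINT x|leb L. f x * h x) / (F * N) = (LINT x|leb L. f x * h x / (F * N))" by simp
  also have "\<dots> \<le> (LINT x|leb L. f x powr q / (q * F powr q) + h x powr r / (r * N powr r))"
  proof (rule integral_leb_mono[OF cfh])
    show "continuous_on {0..L} (\<lambda>x. f x powr q / (q * F powr q) + h x powr r / (r * N powr r))"
      using q pos by (intro continuous_on_add continuous_on_divide continuous_on_const cf ch) auto
    fix x
    have "f x / F * (h x / N) \<le> (f x / F) powr q / q + (h x / N) powr r / r"
      using q f h pos by (intro Youngs_inequality) auto
    then show "f x * h x / (F * N) \<le> f x powr q / (q * F powr q) + h x powr r / (r * N powr r)"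
      using f h pos by (simp add: powr_divide mult.commute)
  qed
  also have "\<dots> = (LINT x|leb L. f x powr q) / (q * F powr q) + (LINT x|leb L. h x powr r) / (r * N powr r)"
    using int by simp
  also have "\<dots> \<le> F powr q / (q * F powr q) + N powr r / (r * N powr r)"
    using F N q pos by (intro add_mono divide_right_mono) auto
  also have "\<dots> = 1" using q pos by simp
  finally show ?thesis using pos by (simp add: field_simps)
qed

text \<open>Hoelder with the conjugate exponent \<open>r\<close> bounds the weighted integral by the
  norm of the positive part of \<open>b\<close> times \<open>N\<close>, the norm of v^2 with
  exponent \<open>r\<close>. This \<open>N\<close> is exactly the denominator of
  \<open>I_functional\<close>, so the definition of \<open>beta\<close> concludes.\<close>

lemma weighted_integral_less:
  assumes L: "0 < L" and v: "v \<in> X_space L (ereal q)" "continuous_on {0..L} v"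
    and nz: "x0 \<in> {0..L}" "v x0 \<noteq> 0" and q: "1 < q"
    and b: "continuous_on {0..L} b" and less: "Lp_norm L (ereal q) (\<lambda>x. max (b x) 0) < beta L (ereal q)"
  shows "(LINT x|leb L. b x * (v x)\<^sup>2) < (LINT x|leb L. (weak_deriv L v x)\<^sup>2)"
proof -
  define r where "r = q / (q - 1)"
  have r: "1 < r" "1 / q + 1 / r = 1" using q by (auto simp: r_def field_simps)
  define N where "N = (LINT x|leb L. \<bar>v x\<bar> powr (2 * r)) powr (1 / r)"
  have rr: "2 * q / (q - 1) = 2 * r" "(q - 1) / q = 1 / r" by (simp_all add: r_def)
  have c2r: "continuous_on {0..L} (\<lambda>x. \<bar>v x\<bar> powr (2 * r))"
    using v(2) r by (intro continuous_on_abs_powr) auto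
  have "(LINT x|leb L. \<bar>v x\<bar> powr (2 * r)) \<noteq> 0"
  proof
    assume "(LINT x|leb L. \<bar>v x\<bar> powr (2 * r)) = 0"
    then have "AE x in leb L. \<bar>v x\<bar> powr (2 * r) = 0"
      using integral_nonneg_eq_0_iff_AE[OF integrable_leb_continuous[OF c2r]] by simp
    then show False using continuous_not_AE_0[OF L c2r nz(1)] nz(2) by simp
  qed
  moreover have "(LINT x|leb L. \<bar>v x\<bar> powr (2 * r)) \<ge> 0" by simp
  ultimately have N: "0 < N" "N powr r = (LINT x|leb L. \<bar>v x\<bar> powr (2 * r))"
    using r by (auto simp: N_def powr_powr)
  have beta: "beta L (ereal q) \<le> (LINT x|leb L. (weak_deriv L v x)\<^sup>2) / N"
    using beta_le_I_functional[OF v(1) continuous_not_AE_0[OF L v(2) nz]] q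
    by (simp add: I_functional_def rr N_def one_ereal_def)
  define F0 where "F0 = Lp_norm L (ereal q) (\<lambda>x. max (b x) 0)"
  have F0: "F0 = (LINT x|leb L. max (b x) 0 powr q) powr (1 / q)"
    by (simp add: F0_def Lp_norm_def)
  \<comment> \<open>\<open>F0\<close> may vanish, but Young's inequality needs a positive bound.\<close>
  define F where "F = (F0 + beta L (ereal q)) / 2"
  have "0 \<le> F0" by (simp add: F0)
  then have F: "0 < F" "F0 \<le> F" "F < beta L (ereal q)"
    using less by (auto simp: F_def F0_def[symmetric])
  have cb: "continuous_on {0..L} (\<lambda>x. max (b x) 0)" using b by (intro continuous_intros)
  have "(LINT x|leb L. b x * (v x)\<^sup>2) \<le> (LINT x|leb L. max (b x) 0 * (v x)\<^sup>2)"
    using b v(2) by (intro integral_leb_mono continuous_intros mult_right_mono) auto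
  also have "\<dots> \<le> F * N"
  proof (rule Holder_integral_leb[OF cb _ _ _ q r(1,2) F(1) N(1)])
    have "(LINT x|leb L. max (b x) 0 powr q) = F0 powr q"
      using q by (simp add: F0 powr_powr)
    also have "\<dots> \<le> F powr q" using F \<open>0 \<le> F0\<close> q by (intro powr_mono2) auto
    finally show "(LINT x|leb L. max (b x) 0 powr q) \<le> F powr q" .
    have "(\<bar>v x\<bar> powr 2) powr r = \<bar>v x\<bar> powr (2 * r)" for x
      by (simp only: powr_powr)
    then have "(v x)\<^sup>2 powr r = \<bar>v x\<bar> powr (2 * r)" for x
      by simp
    then show "(LINT x|leb L. (v x)\<^sup>2 powr r) \<le> N powr r" by (simp add: N)
  qed (use v(2) in \<open>auto intro: continuous_intros\<close>)
  also have "\<dots> < beta L (ereal q) * N" using F N by simp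
  also have "\<dots> \<le> (LINT x|leb L. (weak_deriv L v x)\<^sup>2)"
    using beta N by (simp add: field_simps)
  finally show ?thesis .
qed

text \<open>By continuity the essential supremum bounds \<open>b\<close> at every point, so the
  weight can be replaced by a constant below \<open>beta L \<infinity>\<close>.\<close>

lemma weighted_integral_less_infinity:
  assumes L: "0 < L" and v: "v \<in> X_space L \<infinity>" "continuous_on {0..L} v"
    and nz: "x0 \<in> {0..L}" "v x0 \<noteq> 0"
    and b: "continuous_on {0..L} b" and less: "Lp_norm L \<infinity> (\<lambda>x. max (b x) 0) < beta L \<infinity>"
  shows "(LINT x|leb L. b x * (v x)\<^sup>2) < (LINT x|leb L. (weak_deriv L v x)\<^sup>2)"
proof -
  define N where "N = (LINT x|leb L. (v x)\<^sup>2)"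
  define F where "F = Lp_norm L \<infinity> (\<lambda>x. max (b x) 0)"
  have c2: "continuous_on {0..L} (\<lambda>x. (v x)\<^sup>2)" using v(2) by (intro continuous_intros)
  have "N \<noteq> 0"
  proof
    assume "N = 0"
    then have "AE x in leb L. (v x)\<^sup>2 = 0"
      using integral_nonneg_eq_0_iff_AE[OF integrable_leb_continuous[OF c2]] by (simp add: N_def)
    then show False using continuous_not_AE_0[OF L c2 nz(1)] nz(2) by simp
  qed
  moreover have "N \<ge> 0" by (simp add: N_def)
  ultimately have N: "0 < N" by simp
  have beta: "beta L \<infinity> \<le> (LINT x|leb L. (weak_deriv L v x)\<^sup>2) / N"
    using beta_le_I_functional[OF v(1) continuous_not_AE_0[OF L v(2) nz]]
    by (simp add: I_functional_def N_def)
  have cb: "continuous_on {0..L} (\<lambda>x. max (b x) 0)" using b by (intro continuous_intros)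
  have "(LINT x|leb L. b x * (v x)\<^sup>2) \<le> (LINT x|leb L. F * (v x)\<^sup>2)"
  proof (rule integral_leb_mono)
    fix x assume "x \<in> {0..L}"
    then have "\<bar>max (b x) 0\<bar> \<le> F"
      unfolding F_def by (rule abs_le_Lp_norm_infinity[OF L cb])
    then show "b x * (v x)\<^sup>2 \<le> F * (v x)\<^sup>2" by (intro mult_right_mono) auto
  qed (use b v(2) in \<open>auto intro!: continuous_intros\<close>)
  also have "\<dots> = F * N" by (simp add: N_def)
  also have "\<dots> < beta L \<infinity> * N" using less N by (simp add: F_def)
  also have "\<dots> \<le> (LINT x|leb L. (weak_deriv L v x)\<^sup>2)"
    using beta N by (simp add: field_simps)
  finally show ?thesis .
qed

text \<open>Intermediate value theorem in \<open>k\<close>: if \<open>C\<close> bounds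
  \<open>\<bar>w\<bar>\<close>, then \<open>w + k\<close> is nonpositive for \<open>k = - C\<close>
  and nonnegative for \<open>k = C\<close>. Suitable \<open>\<rho>\<close> give the integral
  constraints in \<open>X_space\<close>.\<close>

lemma exists_shift_integral_eq_0:
  fixes \<rho> w :: "real \<Rightarrow> real"
  assumes L: "0 < L" and w: "continuous_on {0..L} w" and \<rho>: "continuous_on UNIV \<rho>"
    and sign: "\<And>y. 0 \<le> y \<Longrightarrow> 0 \<le> \<rho> y" "\<And>y. y \<le> 0 \<Longrightarrow> \<rho> y \<le> 0"
  obtains k where "(LINT x|leb L. \<rho> (w x + k)) = 0"
proof -
  define \<Phi> where "\<Phi> k = (LINT x|leb L. \<rho> (w x + k))" for k
  have comp: "continuous_on S (\<lambda>x. \<rho> (f x))" if "continuous_on S f" for f :: "'a::topological_space \<Rightarrow> real" and S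
    using continuous_on_compose2[OF \<rho> that] by simp
  have c: "continuous_on {0..L} (\<lambda>x. \<rho> (w x + k))" for k
    using w by (intro comp continuous_intros)
  have "continuous_on UNIV (\<lambda>k. integral (cbox 0 L) (\<lambda>x. \<rho> (w x + k)))"
  proof (rule integral_continuous_on_param)
    have "continuous_on (UNIV \<times> cbox 0 L) (\<lambda>p. \<rho> (w (snd p) + fst p))"
      by (intro comp continuous_intros continuous_on_compose2[OF w]) auto
    then show "continuous_on (UNIV \<times> cbox 0 L) (\<lambda>(k, x). \<rho> (w x + k))"
      by (simp add: case_prod_unfold)
  qed
  then have cont: "continuous_on UNIV \<Phi>"
    using integral_leb[OF integrable_leb_continuous[OF c]] by (simp add: \<Phi>_def[abs_def])
  have "compact (w ` {0..L})" using w by (intro compact_continuous_image) auto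
  then obtain C where C: "\<And>x. x \<in> {0..L} \<Longrightarrow> norm (w x) \<le> C"
    by (meson bounded_iff compact_imp_bounded imageI)
  have C': "- C \<le> w x" "w x \<le> C" if "x \<in> {0..L}" for x using C[OF that] by auto
  have "\<Phi> (- C) \<le> (LINT x|leb L. 0)"
    unfolding \<Phi>_def by (rule integral_leb_mono[OF c]) (use C' in \<open>auto intro: sign(2)\<close>)
  then have "\<Phi> (- C) \<le> 0" by simp
  moreover have "(LINT x|leb L. 0) \<le> \<Phi> C"
    unfolding \<Phi>_def
  proof (rule integral_leb_mono[OF _ c])
    fix x assume "x \<in> {0..L}"
    then show "0 \<le> \<rho> (w x + C)" using C'(1)[of x] by (intro sign(1)) linarith
  qed simp
  then have "0 \<le> \<Phi> C" by simp
  moreover have "- C \<le> C" using C'[of 0] L by force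
  ultimately obtain k where "\<Phi> k = 0"
    using IVT'[of \<Phi> "- C" 0 C] continuous_on_subset[OF cont] by auto
  then show ?thesis by (intro that) (simp add: \<Phi>_def)
qed

lemma weak_deriv_add_const:
  assumes "0 < L" "L2 L w"
  shows "weak_deriv L (\<lambda>x. w x + k) = weak_deriv L w"
  unfolding weak_deriv_def has_weak_deriv_add_const[OF assms(1) L2_imp_integrable[OF assms(2)]] ..

lemma H1_add_const:
  assumes "0 < L" "w \<in> H1 L" "continuous_on {0..L} w"
  shows "(\<lambda>x. w x + k) \<in> H1 L"
proof -
  have w: "L2 L w" using assms(2) by (simp add: H1_def)
  have "L2 L (\<lambda>x. w x + k)"
    using assms(3) by (intro L2_continuous continuous_intros)
  then show ?thesis
    using assms(2) has_weak_deriv_add_const[OF assms(1) L2_imp_integrable[OF w]]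
    by (simp add: H1_def)
qed

text \<open>A shift leaves the weak derivative unchanged, so it can be used freely to reach the
  constraint space. If the shifted function vanishes, both integrals are zero and strictness fails,
  hence the first alternative.\<close>

lemma exists_shift_weighted_integral_less:
  assumes L: "0 < L" and w: "w \<in> H1 L" "continuous_on {0..L} w"
    and b: "continuous_on {0..L} b" and p: "1 \<le> p"
    and less: "1 < p \<Longrightarrow> Lp_norm L p (\<lambda>x. max (b x) 0) < beta L p"
    and le: "p = 1 \<Longrightarrow> Lp_norm L p (\<lambda>x. max (b x) 0) \<le> beta L p"
  obtains k where "(\<forall>x\<in>{0..L}. w x + k = 0) \<or>
    (LINT x|leb L. b x * (w x + k)\<^sup>2) < (LINT x|leb L. (weak_deriv L w x)\<^sup>2)"
proof -
  have H1: "(\<lambda>x. w x + k) \<in> H1 L" and cont: "continuous_on {0..L} (\<lambda>x. w x + k)" for k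
    using H1_add_const[OF L w] w(2) by (auto intro: continuous_intros)
  have wd: "weak_deriv L (\<lambda>x. w x + k) = weak_deriv L w" for k
    using weak_deriv_add_const[OF L] w(1) by (simp add: H1_def)
  consider "p = 1" | "p = \<infinity>" | q where "p = ereal q" "1 < q"
    using p by (cases p) (auto simp: one_ereal_def order_le_less)
  then show ?thesis
  proof cases
    case 1
    \<comment> \<open>Minus the midpoint of the range of \<open>w\<close>: after this shift the two
      extrema are opposite.\<close>
    define k where "k = - (Sup (w ` {0..L}) + Inf (w ` {0..L})) / 2"
    have "\<exists>s\<in>{0..L}. \<forall>y\<in>{0..L}. w y \<le> w s" "\<exists>t\<in>{0..L}. \<forall>y\<in>{0..L}. w t \<le> w y"
      using w(2) L by (auto intro!: continuous_attains_sup continuous_attains_inf)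
    then obtain s t where st: "s \<in> {0..L}" "t \<in> {0..L}"
      "\<And>y. y \<in> {0..L} \<Longrightarrow> w y \<le> w s" "\<And>y. y \<in> {0..L} \<Longrightarrow> w t \<le> w y"
      by blast
    have Sup: "Sup ((\<lambda>x. w x + c) ` {0..L}) = w s + c"
      and Inf: "Inf ((\<lambda>x. w x + c) ` {0..L}) = w t + c" for c
      using st by (auto intro!: cSup_eq_maximum cInf_eq_minimum)
    have "k = - (w s + w t) / 2"
      using Sup[of 0] Inf[of 0] by (simp add: k_def)
    then have ext: "Sup ((\<lambda>x. w x + k) ` {0..L}) + Inf ((\<lambda>x. w x + k) ` {0..L}) = 0"
      unfolding Sup Inf by (simp add: field_simps)
    have "(LINT x|leb L. max (b x) 0) \<le> 4 / L"
      using le[OF 1] beta_1_le[OF L] 1 by (simp add: Lp_norm_def one_ereal_def)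
    from weighted_integral_less_1[OF L H1 cont ext _ _ b this]
    have "(LINT x|leb L. b x * (w x + k)\<^sup>2) < (LINT x|leb L. (weak_deriv L w x)\<^sup>2)"
      if "x0 \<in> {0..L}" "w x0 + k \<noteq> 0" for x0
      using that by (simp add: wd)
    then show ?thesis using that[of k] by blast
  next
    case 2
    obtain k where "(LINT x|leb L. w x + k) = 0"
      using exists_shift_integral_eq_0[OF L w(2), of "\<lambda>y. y"] by auto
    then have X: "(\<lambda>x. w x + k) \<in> X_space L \<infinity>"
      using H1 by (simp add: X_space_def)
    have "Lp_norm L \<infinity> (\<lambda>x. max (b x) 0) < beta L \<infinity>" using less 2 by simp
    from weighted_integral_less_infinity[OF L X cont _ _ b this]
    have "(LINT x|leb L. b x * (w x + k)\<^sup>2) < (LINT x|leb L. (weak_deriv L w x)\<^sup>2)"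
      if "x0 \<in> {0..L}" "w x0 + k \<noteq> 0" for x0
      using that by (simp add: wd)
    then show ?thesis using that[of k] by blast
  next
    case 3
    obtain k where "(LINT x|leb L. \<bar>w x + k\<bar> powr (2 / (q - 1)) * (w x + k)) = 0"
    proof (rule exists_shift_integral_eq_0[OF L w(2), of "\<lambda>y. \<bar>y\<bar> powr (2 / (q - 1)) * y"])
      show "continuous_on UNIV (\<lambda>y::real. \<bar>y\<bar> powr (2 / (q - 1)) * y)"
        using 3 by (intro continuous_intros continuous_on_abs_powr) auto
    qed (auto intro: mult_nonneg_nonpos)
    then have X: "(\<lambda>x. w x + k) \<in> X_space L (ereal q)"
      using H1 3 by (simp add: X_space_def one_ereal_def)
    have "Lp_norm L (ereal q) (\<lambda>x. max (b x) 0) < beta L (ereal q)"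
      using less 3 by (simp add: one_ereal_def)
    from weighted_integral_less[OF L X cont _ _ 3(2) b this]
    have "(LINT x|leb L. b x * (w x + k)\<^sup>2) < (LINT x|leb L. (weak_deriv L w x)\<^sup>2)"
      if "x0 \<in> {0..L}" "w x0 + k \<noteq> 0" for x0
      using that by (simp add: wd)
    then show ?thesis using that[of k] by blast
  qed
qed

subsection \<open>Weak solutions of the Neumann problem\<close>

lemma weak_deriv_cong_AE:
  assumes "v \<in> borel_measurable (leb L)" "w \<in> borel_measurable (leb L)" "AE x in leb L. v x = w x"
  shows "weak_deriv L v = weak_deriv L w"
  unfolding weak_deriv_def has_weak_deriv_cong_AE[OF assms] ..

lemma bilinear_form_eq_sum:
  fixes M :: "real^'n^'n"
  shows "(M *v u) \<bullet> v = (\<Sum>i\<in>UNIV. (\<Sum>j\<in>UNIV. M $ i $ j * u $ j) * v $ i)"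
  by (simp add: inner_vec_def matrix_vector_mult_def)

lemma continuous_on_bilinear_form:
  fixes A :: "real \<Rightarrow> real^'n^'n"
  assumes "\<And>i j. continuous_on S (\<lambda>x. A x $ i $ j)"
    and "\<And>i. continuous_on S (\<lambda>x. f x $ i)" "\<And>i. continuous_on S (\<lambda>x. g x $ i)"
  shows "continuous_on S (\<lambda>x. (A x *v f x) \<bullet> g x)"
  unfolding bilinear_form_eq_sum
  by (intro continuous_on_sum continuous_on_mult assms)

lemma weak_deriv_const:
  assumes "0 < L"
  shows "AE x in leb L. weak_deriv L (\<lambda>_. c) x = 0" and "(\<lambda>_. c) \<in> H1 L"
proof -
  have L2: "L2 L (\<lambda>_. c')" for c' by (intro L2_continuous continuous_intros)
  have wd: "has_weak_deriv L (\<lambda>_. c) (\<lambda>_. 0)"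
    using has_weak_deriv_antiderivative[OF assms L2[of 0], of c] by simp
  then show "(\<lambda>_. c) \<in> H1 L" using L2 by (auto simp: H1_def)
  from has_weak_deriv_unique[OF has_weak_deriv_weak_deriv[OF this] wd]
  show "AE x in leb L. weak_deriv L (\<lambda>_. c) x = 0" .
qed

text \<open>Serves to pass to a continuous representative, and later to turn a solution that is
  constant on \<open>{0..L}\<close> into a constant solution. The weak derivatives of
  \<open>u\<close> and \<open>w\<close> coincide as functions.\<close>

lemma neumann_solution_cong_AE:
  fixes A :: "real \<Rightarrow> real^'n^'n"
  assumes A: "\<And>i j. continuous_on {0..L} (\<lambda>x. A x $ i $ j)"
    and u: "neumann_solution L A u"
    and w: "\<And>i. continuous_on {0..L} (\<lambda>x. w x $ i)" and ae: "AE x in leb L. u x = w x"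
  shows "neumann_solution L A w"
proof -
  have uH: "(\<lambda>x. u x $ i) \<in> H1 L" for i
    using u by (simp add: neumann_solution_def H1_vec_def)
  have um: "(\<lambda>x. u x $ i) \<in> borel_measurable (leb L)" and wm: "(\<lambda>x. w x $ i) \<in> borel_measurable (leb L)" for i
    using uH[of i] L2_continuous[OF w[of i]] by (auto simp: H1_def L2_def)
  have aei: "AE x in leb L. u x $ i = w x $ i" for i
    using ae by eventually_elim simp
  have wH: "(\<lambda>x. w x $ i) \<in> H1 L" for i
    using uH[of i] L2_continuous[OF w[of i]] has_weak_deriv_cong_AE[OF um wm aei, of i] by (simp add: H1_def)
  have wd: "weak_deriv_vec L u = weak_deriv_vec L w"
    using weak_deriv_cong_AE[OF um wm aei] by (auto simp: weak_deriv_vec_def fun_eq_iff)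
  have Am: "(\<lambda>x. A x $ i $ j) \<in> borel_measurable (leb L)" for i j
    using integrable_leb_continuous[OF A[of i j]] by auto
  have "(LINT x|leb L. (A x *v u x) \<bullet> v x) = (LINT x|leb L. (A x *v w x) \<bullet> v x)" if "v \<in> H1_vec L" for v
  proof (rule integral_cong_AE)
    have vm: "(\<lambda>x. v x $ i) \<in> borel_measurable (leb L)" for i
      using that by (auto simp: H1_vec_def H1_def L2_def)
    show "(\<lambda>x. (A x *v u x) \<bullet> v x) \<in> borel_measurable (leb L)" "(\<lambda>x. (A x *v w x) \<bullet> v x) \<in> borel_measurable (leb L)"
      unfolding bilinear_form_eq_sum
      by (intro borel_measurable_sum borel_measurable_times Am um wm vm)+
    show "AE x in leb L. (A x *v u x) \<bullet> v x = (A x *v w x) \<bullet> v x"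
      using ae by eventually_elim simp
  qed
  then show ?thesis
    using u wH unfolding neumann_solution_def by (simp add: H1_vec_def wd)
qed

text \<open>Extrema and shifts refer to values at points, so each component is replaced by its
  continuous representative; finitely many null sets are discarded.\<close>

lemma neumann_solution_continuous_representative:
  fixes A :: "real \<Rightarrow> real^'n^'n"
  assumes L: "0 < L" and A: "\<And>i j. continuous_on {0..L} (\<lambda>x. A x $ i $ j)"
    and u: "neumann_solution L A u"
  obtains w where "neumann_solution L A w" "\<And>i. continuous_on {0..L} (\<lambda>x. w x $ i)"
    "AE x in leb L. u x = w x"
proof -
  have "\<exists>w. continuous_on {0..L} w \<and> (AE x in leb L. u x $ i = w x)" for i
  proof -
    have "(\<lambda>x. u x $ i) \<in> H1 L"
      using u by (simp add: neumann_solution_def H1_vec_def)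
    then have "L2 L (\<lambda>x. u x $ i)" "has_weak_deriv L (\<lambda>x. u x $ i) (weak_deriv L (\<lambda>x. u x $ i))"
      using has_weak_deriv_weak_deriv by (auto simp: H1_def)
    from weak_deriv_imp_continuous_representative[OF L this] show ?thesis by metis
  qed
  then obtain W where W: "\<And>i. continuous_on {0..L} (W i)" "\<And>i. AE x in leb L. u x $ i = W i x"
    by metis
  define w where "w x = (\<chi> i. W i x)" for x
  have "AE x in leb L. \<forall>i. u x $ i = W i x"
    using W(2) by (rule eventually_all_finite)
  then have ae: "AE x in leb L. u x = w x"
    by eventually_elim (simp add: vec_eq_iff w_def)
  have cont: "continuous_on {0..L} (\<lambda>x. w x $ i)" for i
    using W(1)[of i] by (simp add: w_def)
  show ?thesis
    using neumann_solution_cong_AE[OF A u cont ae] cont ae by (rule that)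
qed

theorem theorem2p3:
  fixes L :: real
    and A B :: "real \<Rightarrow> real^'n^'n"
    and p :: "'n \<Rightarrow> ereal"
  assumes "L > 0"
    and "\<And>x. x \<in> {0..L} \<Longrightarrow> transpose (A x) = A x"
    and "\<And>i j. continuous_on {0..L} (\<lambda>x. A x $ i $ j)"
    and "\<And>k. neumann_solution L A (\<lambda>_. k) \<Longrightarrow> k = 0"
    and "\<And>k. (LINT x|leb L. (A x *v k) \<bullet> k) \<ge> 0"
    and "\<And>x i j. x \<in> {0..L} \<Longrightarrow> i \<noteq> j \<Longrightarrow> B x $ i $ j = 0"
    and "\<And>i. continuous_on {0..L} (\<lambda>x. B x $ i $ i)"
    and "\<And>i. 1 \<le> p i"
    and "\<And>x. x \<in> {0..L} \<Longrightarrow> psd (B x - A x)"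
    and "\<And>i. 1 < p i \<Longrightarrow> Lp_norm L (p i) (\<lambda>x. max (B x $ i $ i) 0) < beta L (p i)"
    and "\<And>i. p i = 1 \<Longrightarrow> Lp_norm L (p i) (\<lambda>x. max (B x $ i $ i) 0) \<le> beta L (p i)"
  shows "\<forall>u. neumann_solution L A u \<longrightarrow> (AE x in leb L. u x = 0)"
proof (intro allI impI)
  note L = assms(1) and sym = assms(2) and contA = assms(3) and contB = assms(7)
  fix u assume "neumann_solution L A u"
  then obtain w where sol: "neumann_solution L A w" and cont: "\<And>i. continuous_on {0..L} (\<lambda>x. w x $ i)"
    and uw: "AE x in leb L. u x = w x"
    using neumann_solution_continuous_representative[OF L contA] by metis
  have wH: "(\<lambda>x. w x $ i) \<in> H1 L" for i
    using sol by (simp add: neumann_solution_def H1_vec_def)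
  define D where "D i = (LINT x|leb L. (weak_deriv L (\<lambda>y. w y $ i) x)\<^sup>2)" for i
  have "\<exists>c. (\<forall>x\<in>{0..L}. w x $ i + c = 0) \<or> (LINT x|leb L. B x $ i $ i * (w x $ i + c)\<^sup>2) < D i" for i
    unfolding D_def
    by (rule exists_shift_weighted_integral_less
        [OF L wH[of i] cont[of i] contB[of i] assms(8)[of i] assms(10)[of i] assms(11)[of i]]) (assumption | rule exI)+
  then obtain c where c: "\<And>i. (\<forall>x\<in>{0..L}. w x $ i + c i = 0) \<or>
      (LINT x|leb L. B x $ i $ i * (w x $ i + c i)\<^sup>2) < D i"
    using choice[of "\<lambda>i c. (\<forall>x\<in>{0..L}. w x $ i + c = 0) \<or>
      (LINT x|leb L. B x $ i $ i * (w x $ i + c)\<^sup>2) < D i"] by blast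
  define k where "k = (\<chi> i. c i)"
  have energy: "(LINT x|leb L. (A x *v w x) \<bullet> w x) = (\<Sum>i\<in>UNIV. D i)"
  proof -
    have "w \<in> H1_vec L" using sol by (simp add: neumann_solution_def)
    then have "(LINT x|leb L. (A x *v w x) \<bullet> w x) = (LINT x|leb L. weak_deriv_vec L w x \<bullet> weak_deriv_vec L w x)"
      using sol by (simp add: neumann_solution_def)
    also have "\<dots> = (LINT x|leb L. (\<Sum>i\<in>UNIV. (weak_deriv L (\<lambda>y. w y $ i) x)\<^sup>2))"
      by (simp add: inner_vec_def weak_deriv_vec_def power2_eq_square)
    also have "\<dots> = (\<Sum>i\<in>UNIV. D i)"
      unfolding D_def using has_weak_deriv_weak_deriv[OF wH]
      by (intro Bochner_Integration.integral_sum) (simp add: has_weak_deriv_def L2_def)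
    finally show ?thesis .
  qed
  have mean: "(LINT x|leb L. (A x *v w x) \<bullet> k) = 0"
  proof -
    have "(\<lambda>_. k) \<in> H1_vec L" using weak_deriv_const(2)[OF L] by (simp add: H1_vec_def)
    then have "(LINT x|leb L. (A x *v w x) \<bullet> k) = (LINT x|leb L. weak_deriv_vec L w x \<bullet> weak_deriv_vec L (\<lambda>_. k) x)"
      using sol by (simp add: neumann_solution_def)
    also have "\<dots> = 0"
    proof (rule integral_eq_zero_AE)
      have "AE x in leb L. \<forall>i. weak_deriv L (\<lambda>_. k $ i) x = 0"
        using weak_deriv_const(1)[OF L] by (intro eventually_all_finite)
      then show "AE x in leb L. weak_deriv_vec L w x \<bullet> weak_deriv_vec L (\<lambda>_. k) x = 0"
        by eventually_elim (simp add: inner_vec_def weak_deriv_vec_def)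
    qed
    finally show ?thesis .
  qed
  have contk: "continuous_on {0..L} (\<lambda>x. (w x + k) $ i)" for i
    using cont[of i] by (auto intro: continuous_intros)
  have int: "integrable (leb L) (\<lambda>x. (A x *v w x) \<bullet> w x)" "integrable (leb L) (\<lambda>x. (A x *v w x) \<bullet> k)"
    "integrable (leb L) (\<lambda>x. (A x *v k) \<bullet> k)"
    by (intro integrable_leb_continuous continuous_on_bilinear_form contA cont continuous_on_const)+
  \<comment> \<open>The term \<open>2 * 0\<close> holds the place of the two cross terms in the
    expansion of the quadratic form at \<open>w x + k\<close>: symmetry of \<open>A x\<close> makes
    them equal and \<open>mean\<close> makes their integral zero.\<close>
  have "(\<Sum>i\<in>UNIV. D i) \<le> (\<Sum>i\<in>UNIV. D i) + 2 * 0 + (LINT x|leb L. (A x *v k) \<bullet> k)"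
    using assms(5)[of k] by simp
  also have "\<dots> = (LINT x|leb L. (A x *v w x) \<bullet> w x + 2 * ((A x *v w x) \<bullet> k) + (A x *v k) \<bullet> k)"
    using int by (simp add: energy mean)
  also have "\<dots> = (LINT x|leb L. (A x *v (w x + k)) \<bullet> (w x + k))"
  proof (rule Bochner_Integration.integral_cong)
    fix x assume "x \<in> space (leb L)"
    then have "transpose (A x) = A x" using sym by simp
    then have "(A x *v k) \<bullet> w x = (A x *v w x) \<bullet> k"
      by (metis dot_lmul_matrix inner_commute transpose_matrix_vector)
    then show "(A x *v w x) \<bullet> w x + 2 * ((A x *v w x) \<bullet> k) + (A x *v k) \<bullet> k = (A x *v (w x + k)) \<bullet> (w x + k)"
      by (simp add: matrix_vector_right_distrib inner_add_left inner_add_right)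
  qed simp
  also have "\<dots> \<le> (LINT x|leb L. (\<Sum>i\<in>UNIV. B x $ i $ i * (w x $ i + c i)\<^sup>2))"
  proof (rule integral_leb_mono)
    show "continuous_on {0..L} (\<lambda>x. (A x *v (w x + k)) \<bullet> (w x + k))"
      by (intro continuous_on_bilinear_form contA contk)
    show "continuous_on {0..L} (\<lambda>x. \<Sum>i\<in>UNIV. B x $ i $ i * (w x $ i + c i)\<^sup>2)"
      by (intro continuous_intros contB cont)
    fix x assume x: "x \<in> {0..L}"
    have "(A x *v (w x + k)) \<bullet> (w x + k) \<le> (B x *v (w x + k)) \<bullet> (w x + k)"
      using assms(9)[OF x] by (simp add: psd_def matrix_vector_mult_diff_rdistrib inner_diff_left)
    also have "\<dots> = (\<Sum>i\<in>UNIV. B x $ i $ i * (w x $ i + c i)\<^sup>2)"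
      unfolding bilinear_form_eq_sum
    proof (rule sum.cong)
      fix i
      have "(\<Sum>j\<in>UNIV. B x $ i $ j * (w x + k) $ j) = (\<Sum>j\<in>{i}. B x $ i $ j * (w x + k) $ j)"
        using assms(6)[OF x] by (intro sum.mono_neutral_right) auto
      then show "(\<Sum>j\<in>UNIV. B x $ i $ j * (w x + k) $ j) * (w x + k) $ i = B x $ i $ i * (w x $ i + c i)\<^sup>2"
        by (simp add: k_def power2_eq_square)
    qed simp
    finally show "(A x *v (w x + k)) \<bullet> (w x + k) \<le> (\<Sum>i\<in>UNIV. B x $ i $ i * (w x $ i + c i)\<^sup>2)" .
  qed
  also have "\<dots> = (\<Sum>i\<in>UNIV. (LINT x|leb L. B x $ i $ i * (w x $ i + c i)\<^sup>2))"
    by (intro Bochner_Integration.integral_sum integrable_leb_continuous continuous_on_mult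
        continuous_on_power continuous_on_add continuous_on_const contB cont)
  finally have le: "(\<Sum>i\<in>UNIV. D i) \<le> (\<Sum>i\<in>UNIV. (LINT x|leb L. B x $ i $ i * (w x $ i + c i)\<^sup>2))" .
  have weighted_le: "(LINT x|leb L. B x $ i $ i * (w x $ i + c i)\<^sup>2) \<le> D i" for i
    using c[of i]
  proof
    assume "\<forall>x\<in>{0..L}. w x $ i + c i = 0"
    then have "(LINT x|leb L. B x $ i $ i * (w x $ i + c i)\<^sup>2) = 0"
      by (intro integral_eq_zero_AE AE_leb_I) simp
    then show ?thesis by (simp add: D_def)
  qed simp
  \<comment> \<open>Every weighted integral is at most \<open>D i\<close>, while \<open>le\<close>
    compares the sums the other way round. A single strict inequality would contradict this, so the
    first alternative of \<open>c\<close> holds for every component.\<close>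
  have "\<not> (LINT x|leb L. B x $ i $ i * (w x $ i + c i)\<^sup>2) < D i" for i
    using le sum_strict_mono_ex1[of UNIV "\<lambda>i. LINT x|leb L. B x $ i $ i * (w x $ i + c i)\<^sup>2" D] weighted_le
    by force
  then have "w x $ i + c i = 0" if "x \<in> {0..L}" for x i
    using c[of i] that by blast
  then have wk: "w x = - k" if "x \<in> {0..L}" for x
    using that by (simp add: vec_eq_iff k_def eq_neg_iff_add_eq_0)
  then have "AE x in leb L. w x = - k" by (intro AE_leb_I) simp
  \<comment> \<open>The solution has become constant, and nontrivial constant solutions are excluded
    by assumption.\<close>
  then have "neumann_solution L A (\<lambda>_. - k)"
    using neumann_solution_cong_AE[OF contA sol, of "\<lambda>_. - k"] by simp
  then have "- k = 0" by (rule assms(4))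
  then have "AE x in leb L. w x = 0" using wk by (intro AE_leb_I) simp
  with uw show "AE x in leb L. u x = 0" by eventually_elim simp
qed

end
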